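(* Let $A$ be a $C^*$-algebra and let $P$ be a projective, unital right $A$-module. Then the trace ideal of $P$ is a semiprime ideal of $A$.
   Context: $C^*$-algebras are not assumed to have a unit; modules are purely algebraic right modules over $A$ viewed as a (possibly non-unital) ring, and projectivity is the usual lifting property for module homomorphisms along surjective module homomorphisms. A right $A$-module $E$ is unital if $E = EA$, that is, every $x \in E$ can be written as $x = x_1a_1 + \ldots + x_na_n$ with $x_j \in E$ and $a_j \in A$. The trace ideal of a right $A$-module $E$ is the set of all finite sums of elements of $A$ lying in the images of right $A$-module homomorphisms $E \to A$; it is a two-sided ideal of $A$. An ideal in $A$ is an additive subgroup $I \subseteq A$ with $aI \cup Ia \subseteq I$ for all $a \in A$, not assumed norm-closed. $J^2$ denotes the additive subgroup generated by $\{xy : x,y \in J\}$. An ideal $I$ is semiprime if for all ideals $J \subseteq A$, $J^2 \subseteq I$ implies $J \subseteq I$. *)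

theory Defs
  imports
    Complex_Main
    "HOL-Algebra.Ring"
    "HOL-Computational_Algebra.Group_Closure"
begin

section \<open>C*-algebras, not assumed unital\<close>

text \<open>The sort \<open>real_normed_algebra\<close> has no unit; \<open>scaleC_of_real\<close> makes the
  complex scalar multiplication extend the inherited real one.\<close>

class cstar_algebra = real_normed_algebra + banach +
  fixes scaleC :: "complex \<Rightarrow> 'a \<Rightarrow> 'a"
    and star :: "'a \<Rightarrow> 'a"
  assumes scaleC_add_right: "scaleC c (x + y) = scaleC c x + scaleC c y"
    and scaleC_add_left: "scaleC (c + d) x = scaleC c x + scaleC d x"
    and scaleC_scaleC: "scaleC c (scaleC d x) = scaleC (c * d) x"
    and scaleC_of_real: "scaleC (complex_of_real r) x = scaleR r x"
    and mult_scaleC_left: "scaleC c x * y = scaleC c (x * y)"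
    and mult_scaleC_right: "x * scaleC c y = scaleC c (x * y)"
    and norm_scaleC: "norm (scaleC c x) = cmod c * norm x"
    and star_add: "star (x + y) = star x + star y"
    and star_scaleC: "star (scaleC c x) = scaleC (cnj c) (star x)"
    and star_mult: "star (x * y) = star y * star x"
    and star_star: "star (star x) = x"
    and norm_star_mult_self: "norm (star x * x) = (norm x)\<^sup>2"


section \<open>Ideals of a possibly non-unital ring\<close>

definition is_ideal :: "'a::ring set \<Rightarrow> bool" where
  "is_ideal I \<longleftrightarrow> 0 \<in> I \<and> (\<forall>x\<in>I. \<forall>y\<in>I. x - y \<in> I) \<and> (\<forall>a. \<forall>x\<in>I. a * x \<in> I \<and> x * a \<in> I)"

definition ideal_square :: "'a::ring set \<Rightarrow> 'a set" where
  "ideal_square J = group_closure {x * y | x y. x \<in> J \<and> y \<in> J}"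

definition semiprime_ideal :: "'a::ring set \<Rightarrow> bool" where
  "semiprime_ideal I \<longleftrightarrow> is_ideal I \<and> (\<forall>J. is_ideal J \<longrightarrow> ideal_square J \<subseteq> I \<longrightarrow> J \<subseteq> I)"


section \<open>Right modules over a possibly non-unital ring\<close>

text \<open>A module is an additively written abelian group of HOL-Algebra with an action; the fields
  \<open>mult\<close> and \<open>one\<close> inherited from the record \<open>ring\<close> play no role.\<close>

record ('x, 'a) rmodule = "'x ring" +
  ract :: "'x \<Rightarrow> 'a \<Rightarrow> 'x" (infixl \<open>\<triangleleft>\<index>\<close> 70)

locale right_module = abelian_group M
  for M :: "('x, 'a::ring) rmodule" (structure) +
  assumes ract_closed: "x \<in> carrier M \<Longrightarrow> x \<triangleleft> a \<in> carrier M"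
    and ract_add_left: "x \<in> carrier M \<Longrightarrow> y \<in> carrier M \<Longrightarrow> (x \<oplus> y) \<triangleleft> a = x \<triangleleft> a \<oplus> y \<triangleleft> a"
    and ract_add_right: "x \<in> carrier M \<Longrightarrow> x \<triangleleft> (a + b) = x \<triangleleft> a \<oplus> x \<triangleleft> b"
    and ract_ract: "x \<in> carrier M \<Longrightarrow> (x \<triangleleft> a) \<triangleleft> b = x \<triangleleft> (a * b)"

definition right_module_hom ::
  "('x, 'a::ring) rmodule \<Rightarrow> ('y, 'a) rmodule \<Rightarrow> ('x \<Rightarrow> 'y) set" where
  "right_module_hom M N =
    {f. f \<in> carrier M \<rightarrow> carrier N \<and>
        (\<forall>x\<in>carrier M. \<forall>y\<in>carrier M. f (x \<oplus>\<^bsub>M\<^esub> y) = f x \<oplus>\<^bsub>N\<^esub> f y) \<and>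
        (\<forall>x\<in>carrier M. \<forall>a. f (x \<triangleleft>\<^bsub>M\<^esub> a) = f x \<triangleleft>\<^bsub>N\<^esub> a)}"

definition regular_module :: "('a::ring, 'a) rmodule" where
  "regular_module = \<lparr>carrier = UNIV, mult = undefined, one = undefined,
     zero = 0, add = (+), ract = (*)\<rparr>"

definition unital_module :: "('x, 'a::ring) rmodule \<Rightarrow> bool" where
  "unital_module E \<longleftrightarrow> (\<forall>x\<in>carrier E. \<exists>(n::nat) y b.
     (\<forall>i<n. y i \<in> carrier E) \<and> x = (\<Oplus>\<^bsub>E\<^esub>i\<in>{..<n}. y i \<triangleleft>\<^bsub>E\<^esub> b i))"

definition trace_ideal :: "('x, 'a::ring) rmodule \<Rightarrow> 'a set" where
  "trace_ideal E = {a. \<exists>(n::nat) c. a = (\<Sum>i<n. c i) \<and>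
     (\<forall>i<n. \<exists>f\<in>right_module_hom E regular_module. c i \<in> f ` carrier E)}"

definition lifts_along ::
  "('p, 'a::ring) rmodule \<Rightarrow> ('m, 'a) rmodule \<Rightarrow> ('n, 'a) rmodule \<Rightarrow> bool" where
  "lifts_along P M N \<longleftrightarrow>
    (\<forall>g\<in>right_module_hom M N. g ` carrier M = carrier N \<longrightarrow>
      (\<forall>f\<in>right_module_hom P N. \<exists>h\<in>right_module_hom P M. \<forall>x\<in>carrier P. g (h x) = f x))"

text \<open>HOL cannot quantify over the types of the test modules inside a definition. The carriers of
  the test modules below are arbitrary subsets of the type \<open>'p \<Rightarrow> int \<times> 'a\<close>, which is
  large enough to contain \<open>P\<close> and the free module on \<open>P\<close> over the unitization
  \<open>int \<times> 'a\<close>. The lemma \<open>projective_module_lifts\<close> below shows that this implies the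
  lifting property against test modules over all types.\<close>

definition projective_module :: "('p, 'a::ring) rmodule \<Rightarrow> bool" where
  "projective_module P \<longleftrightarrow>
    (\<forall>(M :: ('p \<Rightarrow> int \<times> 'a, 'a) rmodule) (N :: ('p \<Rightarrow> int \<times> 'a, 'a) rmodule).
      right_module M \<longrightarrow> right_module N \<longrightarrow> lifts_along P M N)"


subsection \<open>Projectivity does not depend on the type of the test modules\<close>

lemma right_module_regular: "right_module (regular_module :: ('a::ring, 'a) rmodule)"
  by (intro right_module.intro abelian_groupI right_module_axioms.intro)
     (auto simp: regular_module_def algebra_simps intro: exI[of _ "- x" for x])

context right_module
begin

lemma int_act_closed: "x \<in> carrier M \<Longrightarrow> [(n::int)] \<cdot> x \<in> carrier M"
  by (simp add: add.int_pow_closed)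

lemma int_act_ract_left:
  assumes "x \<in> carrier M"
  shows "([(n::int)] \<cdot> x) \<triangleleft> b = [n] \<cdot> (x \<triangleleft> b)"
proof -
  have "(\<lambda>x. x \<triangleleft> b) \<in> hom (add_monoid M) (add_monoid M)"
    by (auto simp: hom_def ract_closed ract_add_left)
  from hom_int_pow[OF this _ add.is_group add.is_group] assms show ?thesis
    by (simp add: add_pow_def)
qed

lemma int_act_ract_right:
  assumes "x \<in> carrier M"
  shows "x \<triangleleft> ([(n::int)] \<cdot>\<^bsub>regular_module\<^esub> b) = [n] \<cdot> (x \<triangleleft> b)"
proof -
  interpret A: right_module "regular_module :: ('a, 'a) rmodule" by (rule right_module_regular)
  have "(\<lambda>b. x \<triangleleft> b) \<in> hom (add_monoid regular_module) (add_monoid M)"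
    using assms by (auto simp: hom_def ract_closed ract_add_right regular_module_def)
  from hom_int_pow[OF this _ A.add.is_group add.is_group] show ?thesis
    by (simp add: add_pow_def regular_module_def)
qed

end

definition unitization_act :: "('x, 'a::ring) rmodule \<Rightarrow> 'x \<Rightarrow> int \<times> 'a \<Rightarrow> 'x" where
  "unitization_act M x u = [fst u] \<cdot>\<^bsub>M\<^esub> x \<oplus>\<^bsub>M\<^esub> x \<triangleleft>\<^bsub>M\<^esub> snd u"

context right_module
begin

lemma ract_zero: "x \<in> carrier M \<Longrightarrow> x \<triangleleft> 0 = \<zero>"
  using ract_add_right[of x 0 0] ract_closed[of x 0] add.l_cancel_one' by fastforce

lemma zero_ract: "\<zero> \<triangleleft> a = \<zero>"
  using ract_add_left[of \<zero> \<zero> a] ract_closed[of \<zero> a] add.l_cancel_one' by fastforce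

lemma unitization_act_closed: "x \<in> carrier M \<Longrightarrow> unitization_act M x u \<in> carrier M"
  by (simp add: unitization_act_def int_act_closed ract_closed)

lemma unitization_act_zero: "x \<in> carrier M \<Longrightarrow> unitization_act M x (0, 0) = \<zero>"
  by (simp add: unitization_act_def ract_zero add_pow_def)

lemma unitization_act_one: "x \<in> carrier M \<Longrightarrow> unitization_act M x (1, 0) = x"
  by (simp add: unitization_act_def ract_zero add.int_pow_1)

lemma unitization_act_add:
  assumes "x \<in> carrier M"
  shows "unitization_act M x (fst u + fst v, snd u + snd v) =
    unitization_act M x u \<oplus> unitization_act M x v"
  using assms
  by (simp add: unitization_act_def add.int_pow_mult ract_add_right int_act_closed ract_closed a_ac)

end

definition unitization_mult :: "int \<times> 'a \<Rightarrow> 'a::ring \<Rightarrow> 'a" where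
  "unitization_mult u b = [fst u] \<cdot>\<^bsub>regular_module\<^esub> b + snd u * b"

lemma unitization_mult_add_left:
  "unitization_mult (fst u + fst v, snd u + snd v) b = unitization_mult u b + unitization_mult v b"
proof -
  interpret A: right_module "regular_module :: ('a, 'a) rmodule" by (rule right_module_regular)
  show ?thesis
    using A.add.int_pow_mult[of b "fst u" "fst v"]
    by (simp add: unitization_mult_def regular_module_def algebra_simps)
qed

lemma unitization_mult_add_right:
  "unitization_mult u (b + c) = unitization_mult u b + unitization_mult u c"
proof -
  interpret A: right_module "regular_module :: ('a, 'a) rmodule" by (rule right_module_regular)
  show ?thesis
    using A.add.int_pow_distrib[of b c "fst u"]
    by (simp add: unitization_mult_def regular_module_def algebra_simps)
qed

lemma unitization_mult_mult: "unitization_mult u b * c = unitization_mult u (b * c)"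
proof -
  interpret A: right_module "regular_module :: ('a, 'a) rmodule" by (rule right_module_regular)
  show ?thesis
    using A.int_act_ract_left[of b "fst u" c]
    by (simp add: unitization_mult_def regular_module_def algebra_simps)
qed

lemma int_act_zero: "[(0::int)] \<cdot>\<^bsub>M\<^esub> x = \<zero>\<^bsub>M\<^esub>"
  by (simp add: add_pow_def)

lemma unitization_mult_0: "unitization_mult (0, a) b = a * b"
  by (simp add: unitization_mult_def int_act_zero) (simp add: regular_module_def)

lemma (in right_module) unitization_act_mult:
  assumes "x \<in> carrier M"
  shows "unitization_act M x (0, unitization_mult u b) = unitization_act M x u \<triangleleft> b"
proof -
  have "unitization_act M x (0, unitization_mult u b) = x \<triangleleft> unitization_mult u b"
    using assms by (simp add: unitization_act_def int_act_zero ract_closed)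
  also have "\<dots> = [fst u] \<cdot> (x \<triangleleft> b) \<oplus> x \<triangleleft> (snd u * b)"
    using assms by (simp add: unitization_mult_def ract_add_right int_act_ract_right)
  also have "\<dots> = unitization_act M x u \<triangleleft> b"
    using assms
    by (simp add: unitization_act_def ract_add_left int_act_closed ract_closed
        int_act_ract_left ract_ract)
  finally show ?thesis .
qed

definition usupp :: "('p \<Rightarrow> int \<times> 'a::ring) \<Rightarrow> 'p set" where
  "usupp \<phi> = {x. \<phi> x \<noteq> (0, 0)}"

definition free_module :: "'p set \<Rightarrow> ('p \<Rightarrow> int \<times> 'a::ring, 'a) rmodule" where
  "free_module X = \<lparr>carrier = {\<phi>. finite (usupp \<phi>) \<and> usupp \<phi> \<subseteq> X},
     mult = undefined, one = undefined, zero = (\<lambda>_. (0, 0)),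
     add = (\<lambda>\<phi> \<psi> x. (fst (\<phi> x) + fst (\<psi> x), snd (\<phi> x) + snd (\<psi> x))),
     ract = (\<lambda>\<phi> b x. (0, unitization_mult (\<phi> x) b))\<rparr>"

lemma unitization_mult_zero: "unitization_mult (0, 0) b = 0"
  by (simp add: unitization_mult_0)

lemma usupp_add:
  "usupp (\<lambda>x. (fst (\<phi> x) + fst (\<psi> x), snd (\<phi> x) + snd (\<psi> x))) \<subseteq> usupp \<phi> \<union> usupp \<psi>"
  by (auto simp: usupp_def)

lemma usupp_mult: "usupp (\<lambda>x. (0, unitization_mult (\<phi> x) b)) \<subseteq> usupp \<phi>"
  by (auto simp: usupp_def unitization_mult_zero)

lemma right_module_free: "right_module (free_module X :: ('p \<Rightarrow> int \<times> 'a::ring, 'a) rmodule)"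
proof (intro right_module.intro abelian_groupI right_module_axioms.intro)
  fix \<phi> \<psi> :: "'p \<Rightarrow> int \<times> 'a" and b :: 'a
  assume \<phi>: "\<phi> \<in> carrier (free_module X)"
  show "\<phi> \<triangleleft>\<^bsub>free_module X\<^esub> b \<in> carrier (free_module X)"
    using \<phi> usupp_mult[of \<phi> b] by (auto simp: free_module_def intro: finite_subset)
  show "\<exists>\<psi>\<in>carrier (free_module X). \<psi> \<oplus>\<^bsub>free_module X\<^esub> \<phi> = \<zero>\<^bsub>free_module X\<^esub>"
  proof
    have "usupp (\<lambda>x. (- fst (\<phi> x), - snd (\<phi> x))) = usupp \<phi>"
      by (auto simp: usupp_def prod_eq_iff)
    then show "(\<lambda>x. (- fst (\<phi> x), - snd (\<phi> x))) \<in> carrier (free_module X)"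
      using \<phi> by (simp add: free_module_def)
  qed (simp add: free_module_def)
  assume \<psi>: "\<psi> \<in> carrier (free_module X)"
  show "\<phi> \<oplus>\<^bsub>free_module X\<^esub> \<psi> \<in> carrier (free_module X)"
    using \<phi> \<psi> usupp_add[of \<phi> \<psi>]
    by (auto simp: free_module_def intro: finite_subset[of _ "usupp \<phi> \<union> usupp \<psi>"])
qed (auto simp: free_module_def usupp_def fun_eq_iff unitization_mult_0 unitization_mult_add_left
    unitization_mult_add_right unitization_mult_mult add_ac)

definition free_eval :: "('x, 'a::ring) rmodule \<Rightarrow> ('p \<Rightarrow> 'x) \<Rightarrow> ('p \<Rightarrow> int \<times> 'a) \<Rightarrow> 'x" where
  "free_eval M m \<phi> = (\<Oplus>\<^bsub>M\<^esub>x\<in>usupp \<phi>. unitization_act M (m x) (\<phi> x))"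

context right_module
begin

lemma finsum_ract:
  assumes "finite S" "f \<in> S \<rightarrow> carrier M"
  shows "(\<Oplus>x\<in>S. f x) \<triangleleft> b = (\<Oplus>x\<in>S. f x \<triangleleft> b)"
  using assms
proof (induction S rule: finite_induct)
  case (insert x S)
  then have "(\<lambda>x. f x \<triangleleft> b) \<in> S \<rightarrow> carrier M" "f x \<in> carrier M" "f \<in> S \<rightarrow> carrier M"
    by (auto simp: Pi_iff ract_closed)
  with insert show ?case
    by (simp add: finsum_insert ract_closed ract_add_left finsum_closed Pi_iff)
qed (simp add: zero_ract)

lemma free_eval_superset:
  assumes "finite S" "usupp \<phi> \<subseteq> S" "m \<in> S \<rightarrow> carrier M"
  shows "free_eval M m \<phi> = (\<Oplus>x\<in>S. unitization_act M (m x) (\<phi> x))"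
  unfolding free_eval_def
  using assms
  by (intro add.finprod_mono_neutral_cong_left)
     (auto simp: usupp_def Pi_iff unitization_act_zero intro!: unitization_act_closed)

lemma free_eval_hom:
  assumes m: "m \<in> X \<rightarrow> carrier M"
  shows "free_eval M m \<in> right_module_hom (free_module X) M"
proof -
  have "free_eval M m \<phi> \<in> carrier M" if "\<phi> \<in> carrier (free_module X)" for \<phi>
    using that m unfolding free_eval_def free_module_def
    by (auto intro!: finsum_closed unitization_act_closed)
  moreover have "free_eval M m (\<phi> \<oplus>\<^bsub>free_module X\<^esub> \<psi>) = free_eval M m \<phi> \<oplus> free_eval M m \<psi>"
    if "\<phi> \<in> carrier (free_module X)" "\<psi> \<in> carrier (free_module X)" for \<phi> \<psi>
  proof -
    let ?S = "usupp \<phi> \<union> usupp \<psi>"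
    have S: "finite ?S" "?S \<subseteq> X" using that by (auto simp: free_module_def)
    have mS: "m \<in> ?S \<rightarrow> carrier M" using S m by auto
    have "free_eval M m (\<phi> \<oplus>\<^bsub>free_module X\<^esub> \<psi>) =
        (\<Oplus>x\<in>?S. unitization_act M (m x) (\<phi> x) \<oplus> unitization_act M (m x) (\<psi> x))"
      using free_eval_superset[OF S(1) usupp_add[of \<phi> \<psi>] mS] mS
      by (auto simp: free_module_def unitization_act_add Pi_iff
          intro!: add.finprod_cong' unitization_act_closed a_closed)
    also have "\<dots> = (\<Oplus>x\<in>?S. unitization_act M (m x) (\<phi> x)) \<oplus>
        (\<Oplus>x\<in>?S. unitization_act M (m x) (\<psi> x))"
      using mS by (intro finsum_addf) (auto intro!: unitization_act_closed)
    also have "\<dots> = free_eval M m \<phi> \<oplus> free_eval M m \<psi>"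
      using free_eval_superset[OF S(1) _ mS, of \<phi>] free_eval_superset[OF S(1) _ mS, of \<psi>] by simp
    finally show ?thesis .
  qed
  moreover have "free_eval M m (\<phi> \<triangleleft>\<^bsub>free_module X\<^esub> b) = free_eval M m \<phi> \<triangleleft> b"
    if "\<phi> \<in> carrier (free_module X)" for \<phi> b
  proof -
    let ?S = "usupp \<phi>"
    have S: "finite ?S" "?S \<subseteq> X" using that by (auto simp: free_module_def)
    have mS: "m \<in> ?S \<rightarrow> carrier M" using S m by auto
    have "free_eval M m (\<phi> \<triangleleft>\<^bsub>free_module X\<^esub> b) =
        (\<Oplus>x\<in>?S. unitization_act M (m x) (\<phi> x) \<triangleleft> b)"
      using free_eval_superset[OF S(1) usupp_mult[of \<phi> b] mS] mS
      by (auto simp: free_module_def unitization_act_mult Pi_iff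
          intro!: add.finprod_cong' unitization_act_closed ract_closed)
    also have "\<dots> = free_eval M m \<phi> \<triangleleft> b"
      unfolding free_eval_def using S mS
      by (intro finsum_ract[symmetric]) (auto intro!: unitization_act_closed)
    finally show ?thesis .
  qed
  ultimately show ?thesis by (auto simp: right_module_hom_def)
qed

lemma free_eval_basis:
  assumes "y \<in> X" "m \<in> X \<rightarrow> carrier M"
  shows "(\<lambda>x. if x = y then (1, 0 :: 'a) else (0, 0)) \<in> carrier (free_module X)"
    and "free_eval M m (\<lambda>x. if x = y then (1, 0) else (0, 0)) = m y"
proof -
  have *: "usupp (\<lambda>x. if x = y then (1::int, 0::'a) else (0, 0)) = {y}"
    by (auto simp: usupp_def)
  show "(\<lambda>x. if x = y then (1, 0 :: 'a) else (0, 0)) \<in> carrier (free_module X)"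
    using assms(1) unfolding free_module_def partial_object.simps mem_Collect_eq * by simp
  show "free_eval M m (\<lambda>x. if x = y then (1, 0) else (0, 0)) = m y"
    using assms unfolding free_eval_def *
    by (simp add: finsum_insert unitization_act_one Pi_iff)
qed

end

lemma right_module_homD:
  assumes "f \<in> right_module_hom M N"
  shows "x \<in> carrier M \<Longrightarrow> f x \<in> carrier N"
    and "x \<in> carrier M \<Longrightarrow> y \<in> carrier M \<Longrightarrow> f (x \<oplus>\<^bsub>M\<^esub> y) = f x \<oplus>\<^bsub>N\<^esub> f y"
    and "x \<in> carrier M \<Longrightarrow> f (x \<triangleleft>\<^bsub>M\<^esub> a) = f x \<triangleleft>\<^bsub>N\<^esub> a"
  using assms by (auto simp: right_module_hom_def)

lemma right_module_hom_comp:
  "f \<in> right_module_hom L M \<Longrightarrow> g \<in> right_module_hom M N \<Longrightarrow>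
    (\<lambda>x. g (f x)) \<in> right_module_hom L N"
  by (auto simp: right_module_hom_def Pi_iff)

lemma hom_unitization_act:
  assumes M: "right_module M" and N: "right_module N"
    and g: "g \<in> right_module_hom M N" and x: "x \<in> carrier M"
  shows "g (unitization_act M x u) = unitization_act N (g x) u"
proof -
  interpret M: right_module M by fact
  interpret N: right_module N by fact
  have "g \<in> hom (add_monoid M) (add_monoid N)"
    using g by (auto simp: right_module_hom_def hom_def)
  from hom_int_pow[OF this _ M.add.is_group N.add.is_group] x
  have "g ([fst u] \<cdot>\<^bsub>M\<^esub> x) = [fst u] \<cdot>\<^bsub>N\<^esub> g x"
    by (simp add: add_pow_def)
  with x show ?thesis
    by (simp add: unitization_act_def right_module_homD[OF g] M.int_act_closed M.ract_closed)
qed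

lemma hom_zero:
  assumes M: "right_module M" and N: "right_module N" and g: "g \<in> right_module_hom M N"
  shows "g \<zero>\<^bsub>M\<^esub> = \<zero>\<^bsub>N\<^esub>"
proof -
  interpret M: right_module M by fact
  interpret N: right_module N by fact
  have "g \<zero>\<^bsub>M\<^esub> \<oplus>\<^bsub>N\<^esub> g \<zero>\<^bsub>M\<^esub> = g \<zero>\<^bsub>M\<^esub>" "g \<zero>\<^bsub>M\<^esub> \<in> carrier N"
    using right_module_homD(2)[OF g, of "\<zero>\<^bsub>M\<^esub>" "\<zero>\<^bsub>M\<^esub>"] right_module_homD(1)[OF g] by simp_all
  then show ?thesis using N.add.l_cancel_one' by fastforce
qed

lemma hom_finsum:
  assumes M: "right_module M" and N: "right_module N" and g: "g \<in> right_module_hom M N"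
    and "finite S" "f \<in> S \<rightarrow> carrier M"
  shows "g (\<Oplus>\<^bsub>M\<^esub>x\<in>S. f x) = (\<Oplus>\<^bsub>N\<^esub>x\<in>S. g (f x))"
proof -
  interpret M: right_module M by fact
  interpret N: right_module N by fact
  from assms(4,5) show ?thesis
  proof (induction S rule: finite_induct)
    case (insert x S)
    then have "(\<lambda>x. g (f x)) \<in> S \<rightarrow> carrier N" "f x \<in> carrier M" "f \<in> S \<rightarrow> carrier M"
      using right_module_homD(1)[OF g] by auto
    with insert show ?case
      by (simp add: M.finsum_insert N.finsum_insert M.finsum_closed right_module_homD[OF g])
  qed (simp add: hom_zero[OF M N g])
qed

lemma hom_free_eval:
  assumes M: "right_module M" and N: "right_module N" and g: "g \<in> right_module_hom M N"
    and m: "m \<in> X \<rightarrow> carrier M" and \<phi>: "\<phi> \<in> carrier (free_module X)"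
  shows "g (free_eval M m \<phi>) = free_eval N (\<lambda>x. g (m x)) \<phi>"
proof -
  interpret M: right_module M by fact
  interpret N: right_module N by fact
  have S: "finite (usupp \<phi>)" "usupp \<phi> \<subseteq> X" using \<phi> by (auto simp: free_module_def)
  have mS: "m x \<in> carrier M" if "x \<in> usupp \<phi>" for x using that m S by auto
  have "g (free_eval M m \<phi>) = (\<Oplus>\<^bsub>N\<^esub>x\<in>usupp \<phi>. g (unitization_act M (m x) (\<phi> x)))"
    unfolding free_eval_def using S mS
    by (intro hom_finsum[OF M N g]) (auto intro!: M.unitization_act_closed)
  also have "\<dots> = free_eval N (\<lambda>x. g (m x)) \<phi>"
    unfolding free_eval_def using mS right_module_homD(1)[OF g]
    by (intro N.add.finprod_cong')
       (auto simp: hom_unitization_act[OF M N g] intro!: N.unitization_act_closed)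
  finally show ?thesis .
qed

lemma projective_module_splits:
  fixes P :: "('p, 'a::ring) rmodule"
  assumes P: "right_module P" and proj: "projective_module P"
  obtains s where "s \<in> right_module_hom P (free_module (carrier P))"
    and "\<And>x. x \<in> carrier P \<Longrightarrow> free_eval P (\<lambda>x. x) (s x) = x"
proof -
  interpret P: right_module P by fact
  define \<iota> :: "'p \<Rightarrow> 'p \<Rightarrow> int \<times> 'a" where "\<iota> y = (\<lambda>x. if x = y then (1, 0) else (0, 0))" for y
  define \<pi> :: "('p \<Rightarrow> int \<times> 'a) \<Rightarrow> 'p" where "\<pi> = inv_into UNIV \<iota>"
  have "inj \<iota>"
    by (rule injI) (metis \<iota>_def fst_conv zero_neq_one)
  then have [simp]: "\<pi> (\<iota> x) = x" for x by (simp add: \<pi>_def)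
  define Q :: "('p \<Rightarrow> int \<times> 'a, 'a) rmodule" where
    "Q = \<lparr>carrier = \<iota> ` carrier P, mult = undefined, one = undefined, zero = \<iota> \<zero>\<^bsub>P\<^esub>,
       add = (\<lambda>u v. \<iota> (\<pi> u \<oplus>\<^bsub>P\<^esub> \<pi> v)), ract = (\<lambda>u a. \<iota> (\<pi> u \<triangleleft>\<^bsub>P\<^esub> a))\<rparr>"
  have Q: "right_module Q"
    by (intro right_module.intro abelian_groupI right_module_axioms.intro)
       (auto simp: Q_def P.a_closed P.a_ac P.l_zero P.ract_closed P.ract_add_left
          P.ract_add_right P.ract_ract intro!: bexI[of _ "\<ominus>\<^bsub>P\<^esub> _"] simp: P.l_neg P.r_neg)
  have \<iota>_hom: "\<iota> \<in> right_module_hom P Q" by (auto simp: right_module_hom_def Q_def)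
  have id: "(\<lambda>x. x) \<in> carrier P \<rightarrow> carrier P" by simp
  let ?e = "\<lambda>\<phi>. \<iota> (free_eval P (\<lambda>x. x) \<phi>)"
  have e: "?e \<in> right_module_hom (free_module (carrier P)) Q"
    by (rule right_module_hom_comp[OF P.free_eval_hom[OF id] \<iota>_hom])
  have "?e ` carrier (free_module (carrier P)) = carrier Q"
  proof
    show "?e ` carrier (free_module (carrier P)) \<subseteq> carrier Q"
      using right_module_homD(1)[OF e] by auto
    show "carrier Q \<subseteq> ?e ` carrier (free_module (carrier P))"
    proof
      fix u assume "u \<in> carrier Q"
      then obtain y where y: "y \<in> carrier P" "u = \<iota> y" by (auto simp: Q_def)
      show "u \<in> ?e ` carrier (free_module (carrier P))"
        using P.free_eval_basis[OF y(1) id] y(2) by (intro image_eqI[of _ _ "\<iota> y"]) (simp_all add: \<iota>_def)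
    qed
  qed
  with proj right_module_free[of "carrier P"] Q e \<iota>_hom
  obtain s where s: "s \<in> right_module_hom P (free_module (carrier P))"
      "\<forall>x\<in>carrier P. ?e (s x) = \<iota> x"
    unfolding projective_module_def lifts_along_def by blast
  show thesis
  proof (rule that[OF s(1)])
    fix x assume "x \<in> carrier P"
    with s(2) have "\<pi> (?e (s x)) = \<pi> (\<iota> x)" by metis
    then show "free_eval P (\<lambda>x. x) (s x) = x" by simp
  qed
qed

lemma projective_module_lifts:
  fixes P :: "('p, 'a::ring) rmodule" and M :: "('m, 'a) rmodule" and N :: "('n, 'a) rmodule"
  assumes P: "right_module P" and proj: "projective_module P"
    and M: "right_module M" and N: "right_module N"
  shows "lifts_along P M N"
  unfolding lifts_along_def
proof (intro ballI impI)
  fix g f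
  assume g: "g \<in> right_module_hom M N" and surj: "g ` carrier M = carrier N"
    and f: "f \<in> right_module_hom P N"
  interpret M: right_module M by fact
  obtain s where s: "s \<in> right_module_hom P (free_module (carrier P))"
      "\<And>x. x \<in> carrier P \<Longrightarrow> free_eval P (\<lambda>x. x) (s x) = x"
    using projective_module_splits[OF P proj] by blast
  have "\<forall>x\<in>carrier P. \<exists>y\<in>carrier M. g y = f x"
    using surj right_module_homD(1)[OF f] by (metis imageE)
  then obtain m where m: "\<And>x. x \<in> carrier P \<Longrightarrow> m x \<in> carrier M"
      "\<And>x. x \<in> carrier P \<Longrightarrow> g (m x) = f x"
    by metis
  have mPi: "m \<in> carrier P \<rightarrow> carrier M" using m by auto
  show "\<exists>h\<in>right_module_hom P M. \<forall>x\<in>carrier P. g (h x) = f x"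
  proof (intro bexI ballI)
    show "(\<lambda>x. free_eval M m (s x)) \<in> right_module_hom P M"
      by (rule right_module_hom_comp[OF s(1) M.free_eval_hom[OF mPi]])
    fix x assume x: "x \<in> carrier P"
    interpret N: right_module N by fact
    have sx: "s x \<in> carrier (free_module (carrier P))"
      using right_module_homD(1)[OF s(1) x] .
    then have sub: "usupp (s x) \<subseteq> carrier P" by (auto simp: free_module_def)
    have "g (free_eval M m (s x)) = free_eval N (\<lambda>y. g (m y)) (s x)"
      by (rule hom_free_eval[OF M N g mPi sx])
    also have "\<dots> = free_eval N (\<lambda>y. f y) (s x)"
      unfolding free_eval_def using sub m(2) right_module_homD(1)[OF f]
      by (intro N.add.finprod_cong') (auto intro!: N.unitization_act_closed)
    also have "\<dots> = f (free_eval P (\<lambda>y. y) (s x))"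
      by (rule hom_free_eval[OF P N f _ sx, symmetric]) simp
    also have "\<dots> = f x" using s(2)[OF x] by simp
    finally show "g (free_eval M m (s x)) = f x" .
  qed
qed

end

theory Submission
  imports Defs "HOL-Analysis.Analysis"
begin

text \<open>Let \<open>T\<close> be the trace ideal, \<open>J\<^sup>2 \<subseteq> T\<close> and \<open>x \<in> J\<close>, so that
  \<open>b = xx\<^sup>*x \<in> T\<close>. A dual basis of \<open>P\<close> gives \<open>b = \<Sum> r\<^sub>i v\<^sub>i\<close> with a column \<open>v\<close> fixed by a
  matrix \<open>e\<close> over \<open>T\<close>, that is \<open>v = ev\<close>. The column \<open>w = vh\<^bsup>-15/32\<^esup>\<close> with \<open>h = v\<^sup>*v\<close>
  exists because \<open>15/32 < 1/2\<close>, and \<open>w = ew\<close>, so its entries lie in \<open>T\<close>. On the other hand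
  \<open>b\<^sup>*b\<close> is bounded by a multiple of \<open>h\<close>, which makes \<open>x\<close> of order \<open>h\<^bsup>1/8\<^esup>\<close>, so that
  \<open>z = xh\<^bsup>-1/16\<^esup>\<close> exists as well, and \<open>x = zh\<^bsup>1/16\<^esup> = zw\<^sup>*w \<in> T\<close>. The negative powers are
  binomial series in \<open>1 - h\<close>, so no functional calculus is needed beyond the positivity of
  \<open>y\<^sup>*y\<close>.\<close>

section \<open>C*-algebras with and without unit\<close>

lemma star_diff: "star (x - y) = star x - star (y::'a::cstar_algebra)"
  using star_add[of "x - y" y] by (simp add: algebra_simps)

lemma star_zero [simp]: "star (0::'a::cstar_algebra) = 0"
  using star_diff[of 0 "0::'a"] by simp

lemma star_minus: "star (- x) = - star (x::'a::cstar_algebra)"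
  using star_diff[of 0 x] by simp

lemma star_scaleR: "star (r *\<^sub>R x) = r *\<^sub>R star (x::'a::cstar_algebra)"
  using star_scaleC[of "complex_of_real r" x] by (simp add: scaleC_of_real)

lemma star_sum: "star (\<Sum>i\<in>I. f i) = (\<Sum>i\<in>I. star (f i :: 'a::cstar_algebra))"
  by (induction I rule: infinite_finite_induct) (simp_all add: star_add)

text \<open>The C*-identity bounds norm y ^2 by norm (star y) * norm y. Cancelling a factor, for x
  and for \<open>star x\<close>, gives equality.\<close>

lemma norm_star [simp]: "norm (star x) = norm (x::'a::cstar_algebra)"
proof -
  have le: "norm y \<le> norm (star y)" for y :: 'a
  proof (cases "y = 0")
    case False
    have "norm y * norm y \<le> norm (star y) * norm y"
      using norm_mult_ineq[of "star y" y] by (simp add: norm_star_mult_self power2_eq_square)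
    with False show ?thesis by simp
  qed simp
  show ?thesis using le[of x] le[of "star x"] by (simp add: star_star)
qed

lemma norm_mult_star_self: "norm (x * star x) = (norm (x::'a::cstar_algebra))\<^sup>2"
  using norm_star_mult_self[of "star x"] by (simp add: star_star)

lemma norm_selfadjoint_square: "star a = a \<Longrightarrow> norm (a * a) = (norm (a::'a::cstar_algebra))\<^sup>2"
  using norm_star_mult_self[of a] by simp

lemma bounded_linear_star: "bounded_linear (star :: 'a::cstar_algebra \<Rightarrow> 'a)"
  by (rule bounded_linear_intro[where K = 1]) (simp_all add: star_add star_scaleR)

lemma scaleC_i_i: "scaleC \<i> (scaleC \<i> x) = - (x::'a::cstar_algebra)"
  using scaleC_of_real[of "-1" x] by (simp add: scaleC_scaleC)

lemma scaleC_minus_right: "scaleC c (- x) = - scaleC c (x::'a::cstar_algebra)"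
  using scaleC_add_right[of c x "- x"] scaleC_add_right[of c 0 "0::'a"]
  by (metis add.right_inverse add_cancel_right_right minus_unique)

lemma scaleC_minus_left: "scaleC (- c) x = - scaleC c (x::'a::cstar_algebra)"
  using scaleC_add_left[of c "- c" x] scaleC_of_real[of 0 x]
  by (metis add.right_inverse minus_unique of_real_0 scaleR_zero_left)

lemma scaleC_diff_right: "scaleC c (x - y) = scaleC c x - scaleC c (y::'a::cstar_algebra)"
  using scaleC_add_right[of c x "- y"] by (simp add: scaleC_minus_right)

text \<open>The vectors \<open>x + icx\<close> and \<open>x - icx\<close> have the same norm because
  \<open>(1 - ic)(1 + ic) = 1 + c\<^sup>2 = (1 + ic)(1 - ic)\<close>, and \<open>x\<close> is their mean.\<close>
lemma norm_le_norm_add_square: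
  fixes c x :: "'a::cstar_algebra"
  assumes c: "star c = c"
  shows "norm x \<le> norm (x + c * (c * x))"
proof -
  define u where "u y = y + scaleC \<i> (c * y)" for y
  define w where "w y = y - scaleC \<i> (c * y)" for y
  have su: "star (u y) = star y - scaleC \<i> (star y * c)" for y
    by (simp add: u_def star_add star_scaleC star_mult c scaleC_minus_left)
  have sw: "star (w y) = star y + scaleC \<i> (star y * c)" for y
    by (simp add: w_def star_diff star_scaleC star_mult c scaleC_minus_left)
  have "star (u y) * u y = star (w y) * w y" for y
    unfolding su sw by (simp add: u_def w_def algebra_simps mult_scaleC_left mult_scaleC_right
        scaleC_add_right scaleC_diff_right)
  then have "(norm (u y))\<^sup>2 = (norm (w y))\<^sup>2" for y
    by (metis norm_star_mult_self)
  then have uw: "norm (u y) = norm (w y)" for y by simp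
  have le: "norm y \<le> norm (w y)" for y
  proof -
    have "norm (2 *\<^sub>R y) = norm (u y + w y)" by (simp add: u_def w_def scaleR_2)
    also have "\<dots> \<le> norm (u y) + norm (w y)" by (rule norm_triangle_ineq)
    finally show ?thesis using uw[of y] by simp
  qed
  have "w (u x) = x + c * (c * x)"
    by (simp add: u_def w_def algebra_simps mult_scaleC_right scaleC_i_i scaleC_add_right)
  then show ?thesis using le[of x] le[of "u x"] uw[of x] by simp
qed

text \<open>The unit may equal 0, since the multiplier algebra of the zero algebra is zero; hence
  the estimate \<open>norm_one_le\<close> instead of an equation.\<close>

class unital_cstar_algebra = cstar_algebra + monoid_mult

lemma star_one [simp]: "star (1::'a::unital_cstar_algebra) = 1"
  using star_mult[of "star (1::'a)" 1] by (simp add: star_star)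

lemma norm_one_le: "norm (1::'a::unital_cstar_algebra) \<le> 1"
proof -
  have "norm (1::'a) = (norm (1::'a))\<^sup>2" using norm_star_mult_self[of "1::'a"] by simp
  then show ?thesis by (metis mult_cancel_right1 order_refl power2_eq_square zero_le_one)
qed

lemma norm_power_le:
  "norm (x ^ n) \<le> norm (x::'a::unital_cstar_algebra) ^ n"
proof (induction n)
  case (Suc n)
  have "norm (x ^ Suc n) \<le> norm x * norm (x ^ n)" by (simp add: norm_mult_ineq)
  also have "\<dots> \<le> norm x * norm x ^ n" by (intro mult_left_mono Suc) simp
  finally show ?case by simp
qed (simp add: norm_one_le)

lemma star_power: "star (x ^ n) = star (x::'a::unital_cstar_algebra) ^ n"
  by (induction n) (simp_all add: star_mult power_commutes)

text \<open>Taking x = 1 - d^2 in \<open>norm_le_norm_add_square\<close> yields norm (1 - d^2) \<le>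
  norm (1 - d^4). Under iteration the power of c tends to 0, and the triangle inequality leaves the
  bound 1.\<close>

lemma norm_one_diff_square_less:
  fixes c :: "'a::unital_cstar_algebra"
  assumes c: "star c = c" and "norm c < 1"
  shows "norm (1 - c * c) \<le> 1"
proof -
  have step: "norm (1 - d * d) \<le> norm (1 - (d * d) * (d * d))" if "star d = d" for d :: 'a
    using norm_le_norm_add_square[OF that, of "1 - d * d"]
    by (simp add: algebra_simps mult.assoc)
  have "norm (1 - c * c) \<le> norm (1 - c ^ 2 ^ Suc m)" for m
  proof (induction m)
    case (Suc m)
    have "norm (1 - c ^ 2 ^ Suc m) \<le> norm (1 - c ^ 2 ^ Suc (Suc m))"
      using step[of "c ^ 2 ^ m"] by (simp add: star_power c power_add[symmetric] mult_2)
    with Suc show ?case by linarith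
  qed (simp add: power2_eq_square)
  also have "norm (1 - c ^ 2 ^ Suc m) \<le> 1 + norm c ^ 2 ^ Suc m" for m
    using norm_triangle_ineq4[of 1 "c ^ 2 ^ Suc m"] norm_one_le[where 'a = 'a]
      norm_power_le[of c "2 ^ Suc m"] by linarith
  finally have le: "norm (1 - c * c) \<le> 1 + norm c ^ 2 ^ Suc m" for m .
  have "(\<lambda>m. norm c ^ (2 ^ Suc m)) \<longlonglongrightarrow> 0"
  proof (rule LIMSEQ_subseq_LIMSEQ[of "\<lambda>n. norm c ^ n" 0 "\<lambda>m. 2 ^ Suc m", unfolded o_def])
    show "(\<lambda>n. norm c ^ n) \<longlonglongrightarrow> 0" using assms by (intro LIMSEQ_power_zero) simp
    show "strict_mono (\<lambda>m. 2 ^ Suc m :: nat)" by (rule strict_monoI) simp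
  qed
  then have "(\<lambda>m. 1 + norm c ^ (2 ^ Suc m)) \<longlonglongrightarrow> 1 + 0" by (intro tendsto_intros)
  with le show ?thesis by (intro LIMSEQ_le_const[where X = "\<lambda>m. 1 + norm c ^ (2 ^ Suc m)"]) auto
qed

text \<open>Division by sqrt u reduces the claim to the open unit ball for every u > norm c ^2;
  letting u decrease to t covers the boundary case, including c = 0.\<close>

lemma norm_diff_square_le:
  fixes c :: "'a::unital_cstar_algebra"
  assumes c: "star c = c" and t: "(norm c)\<^sup>2 \<le> t"
  shows "norm (t *\<^sub>R 1 - c * c) \<le> t"
proof (rule field_le_epsilon)
  have strict: "norm (u *\<^sub>R 1 - c * c) \<le> u" if u: "(norm c)\<^sup>2 < u" for u
  proof -
    have "0 < u" using u by (meson le_less_trans zero_le_power2)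
    define d where "d = (1 / sqrt u) *\<^sub>R c"
    have "norm c < sqrt u" using u by (simp add: real_less_rsqrt)
    then have "norm d < 1" using \<open>0 < u\<close> by (simp add: d_def)
    moreover have "star d = d" by (simp add: d_def star_scaleR c)
    ultimately have "norm (1 - d * d) \<le> 1" by (intro norm_one_diff_square_less)
    moreover have "u *\<^sub>R 1 - c * c = u *\<^sub>R (1 - d * d)"
      using \<open>0 < u\<close> by (simp add: d_def scaleR_diff_right)
    ultimately show ?thesis using \<open>0 < u\<close> by (simp add: mult_left_le)
  qed
  fix e :: real assume "0 < e"
  have "norm (t *\<^sub>R 1 - c * c) \<le> norm ((t + e/2) *\<^sub>R 1 - c * c) + norm ((e/2) *\<^sub>R (1::'a))"
    by (rule order_trans[OF _ norm_triangle_ineq4]) (simp add: algebra_simps)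
  also have "\<dots> \<le> (t + e/2) + e/2 * 1"
    using t \<open>0 < e\<close> norm_one_le[where 'a = 'a] by (intro add_mono strict) (auto intro: mult_left_le)
  finally show "norm (t *\<^sub>R 1 - c * c) \<le> t + e" by simp
qed

section \<open>Positive elements\<close>

text \<open>A norm characterization of self-adjoint elements with nonnegative spectrum. It avoids
  spectra and turns closure under sums into the triangle inequality.\<close>

definition positive_elem :: "'a::unital_cstar_algebra \<Rightarrow> bool" where
  "positive_elem a \<longleftrightarrow> star a = a \<and> (\<exists>t. norm (t *\<^sub>R 1 - a) \<le> t)"

lemma positive_square: "star c = c \<Longrightarrow> positive_elem (c * c)"
  using norm_diff_square_le[of c "(norm c)\<^sup>2"] by (auto simp: positive_elem_def star_mult)

lemma positive_add:
  assumes "positive_elem a" "positive_elem b"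
  shows "positive_elem (a + b)"
proof -
  from assms obtain s t where "norm (s *\<^sub>R 1 - a) \<le> s" "norm (t *\<^sub>R 1 - b) \<le> t"
    by (auto simp: positive_elem_def)
  then have "norm ((s + t) *\<^sub>R 1 - (a + b)) \<le> s + t"
    using norm_triangle_ineq[of "s *\<^sub>R 1 - a" "t *\<^sub>R 1 - b"] by (simp add: algebra_simps)
  with assms show ?thesis by (auto simp: positive_elem_def star_add)
qed

lemma positive_zero: "positive_elem 0"
  by (auto simp: positive_elem_def intro: exI[of _ 0])

lemma positive_sum: "(\<And>i. i \<in> I \<Longrightarrow> positive_elem (f i)) \<Longrightarrow> positive_elem (\<Sum>i\<in>I. f i)"
  by (induction I rule: infinite_finite_induct) (simp_all add: positive_zero positive_add)

lemma positive_scaleR: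
  assumes "positive_elem a" "0 \<le> r"
  shows "positive_elem (r *\<^sub>R a)"
proof -
  from assms obtain t where "norm (t *\<^sub>R 1 - a) \<le> t" by (auto simp: positive_elem_def)
  moreover have "(r * t) *\<^sub>R 1 - r *\<^sub>R a = r *\<^sub>R (t *\<^sub>R 1 - a)"
    by (simp add: scaleR_diff_right)
  ultimately have "norm ((r * t) *\<^sub>R 1 - r *\<^sub>R a) \<le> r * t"
    using assms(2) by (simp add: mult_left_mono)
  with assms show ?thesis by (auto simp: positive_elem_def star_scaleR)
qed

lemma positive_norm_diff:
  fixes k :: "'a::unital_cstar_algebra"
  assumes "star k = k" "norm k \<le> d"
  shows "positive_elem (d *\<^sub>R 1 - k)"
  using assms by (auto simp: positive_elem_def star_diff star_scaleR intro!: exI[of _ d])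

text \<open>The constant \<open>t\<close> in \<^const>\<open>positive_elem\<close> can be any number from \<open>norm a\<close> on:
  \<open>\<lambda> + a\<close> is bounded below by \<open>\<lambda>\<close>, and \<open>(\<lambda> + a)(\<lambda> - a) = \<lambda>\<^sup>2 - a\<^sup>2\<close>.\<close>
lemma positive_norm_le:
  assumes pos: "positive_elem a" and l: "norm a \<le> l"
  shows "norm (l *\<^sub>R 1 - a) \<le> l"
proof (cases "l = 0")
  case False
  with l have l0: "0 < l" using norm_ge_zero[of a] by linarith
  from pos obtain t where t: "norm (t *\<^sub>R 1 - a) \<le> t" and a: "star a = a"
    by (auto simp: positive_elem_def)
  have t0: "0 \<le> t" using t norm_ge_zero order_trans by blast
  have below: "l * norm x \<le> norm (l *\<^sub>R x + a * x)" for x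
  proof -
    have "(l + t) * norm x = norm ((l *\<^sub>R x + a * x) + (t *\<^sub>R 1 - a) * x)"
      using l0 t0 by (simp add: algebra_simps flip: scaleR_add_left)
    also have "\<dots> \<le> norm (l *\<^sub>R x + a * x) + norm (t *\<^sub>R 1 - a) * norm x"
      by (rule order_trans[OF norm_triangle_ineq]) (simp add: norm_mult_ineq)
    also have "\<dots> \<le> norm (l *\<^sub>R x + a * x) + t * norm x"
      using t by (simp add: mult_right_mono)
    finally show ?thesis by (simp add: algebra_simps)
  qed
  have "(l * l) *\<^sub>R 1 - a * a = l *\<^sub>R (l *\<^sub>R 1 - a) + a * (l *\<^sub>R 1 - a)"
    by (simp add: algebra_simps)
  with below[of "l *\<^sub>R 1 - a"] have "l * norm (l *\<^sub>R 1 - a) \<le> norm ((l * l) *\<^sub>R 1 - a * a)" by simp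
  also have "\<dots> \<le> l * l"
    using l l0 by (intro norm_diff_square_le a) (simp add: power2_eq_square mult_mono)
  finally show ?thesis using l0 by simp
qed (use l in simp)

text \<open>With k = norm a, the identity (k + a)^2 - (k - a)^2 = 4ka is estimated by norm (k + a)
  \<le> k + d and norm (k - a) \<le> k. The factor 3 is crude, but any constant independent of a
  serves later.\<close>

lemma positive_bounded:
  assumes a: "positive_elem a" and b: "positive_elem (d *\<^sub>R 1 - a)" and d: "0 \<le> d"
  shows "norm a \<le> 3 * d"
proof (rule ccontr)
  define k where "k = norm a"
  assume "\<not> norm a \<le> 3 * d"
  then have k: "3 * d < k" by (simp add: k_def)
  have n1: "norm (d *\<^sub>R (1::'a)) \<le> d" using d norm_one_le[where 'a = 'a] by (simp add: mult_left_le)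
  have "norm (d *\<^sub>R 1 - a) \<le> d + k"
    using norm_triangle_ineq4[of "d *\<^sub>R 1" a] n1 by (simp add: k_def)
  from positive_norm_le[OF b this] have plus: "norm (k *\<^sub>R 1 + a) \<le> k + d"
    by (simp add: algebra_simps)
  have minus: "norm (k *\<^sub>R 1 - a) \<le> k" by (rule positive_norm_le[OF a]) (simp add: k_def)
  have "(k *\<^sub>R 1 + a) * (k *\<^sub>R 1 + a) - (k *\<^sub>R 1 - a) * (k *\<^sub>R 1 - a) = (4 * k) *\<^sub>R a"
    by (simp add: algebra_simps flip: scaleR_add_left)
  then have "norm ((4 * k) *\<^sub>R a) \<le>
      norm ((k *\<^sub>R 1 + a) * (k *\<^sub>R 1 + a)) + norm ((k *\<^sub>R 1 - a) * (k *\<^sub>R 1 - a))"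
    by (metis norm_triangle_ineq4)
  also have "\<dots> \<le> (k + d) * (k + d) + k * k"
    using plus minus k d
    by (intro add_mono order_trans[OF norm_mult_ineq] mult_mono) auto
  finally have "4 * k * k \<le> (k + d) * (k + d) + k * k" using k d by (simp add: k_def)
  \<comment> \<open>As d < k/3, the estimate becomes 4k^2 \<le> (25/9)k^2.\<close>
  moreover have "(k + d) * (k + d) \<le> (4/3 * k) * (4/3 * k)"
    using k d by (intro mult_mono) auto
  ultimately have "11 * (k * k) \<le> 0" by simp
  moreover have "0 < k * k" using k d by (intro mult_pos_pos) auto
  ultimately show False by linarith
qed

section \<open>Positivity of star squares\<close>

text \<open>The coefficient of X^n in (1 - X)^(-s), so that the series in 1 - h represents
  h^(-s).\<close>

definition binom_coeff :: "real \<Rightarrow> nat \<Rightarrow> real" where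
  "binom_coeff s n = (- 1) ^ n * (- s gchoose n)"

text \<open>Comparing coefficients in (1 - X)^(-s) (1 - X)^(-t) = (1 - X)^(-(s + t)); this is
  Vandermonde's identity.\<close>

lemma binom_coeff_convolution:
  "(\<Sum>k\<le>n. binom_coeff s k * binom_coeff t (n - k)) = binom_coeff (s + t) n"
proof -
  have "(\<Sum>k\<le>n. binom_coeff s k * binom_coeff t (n - k)) =
      (\<Sum>k\<le>n. (- 1) ^ n * ((- s gchoose k) * (- t gchoose (n - k))))"
  proof (rule sum.cong)
    fix k assume "k \<in> {..n}"
    then have "(- 1) ^ n = (- 1 :: real) ^ k * (- 1) ^ (n - k)" by (simp flip: power_add)
    then show "binom_coeff s k * binom_coeff t (n - k) =
        (- 1) ^ n * ((- s gchoose k) * (- t gchoose (n - k)))"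
      by (simp add: binom_coeff_def)
  qed simp
  also have "\<dots> = (- 1) ^ n * (- s - t gchoose n)"
    using gbinomial_Vandermonde[of "- s" "- t" n] by (simp add: sum_distrib_left[symmetric] atLeast0AtMost)
  finally show ?thesis by (simp add: binom_coeff_def)
qed

lemma binom_coeff_one: "binom_coeff 1 n = 1"
  by (simp add: binom_coeff_def gbinomial_minus flip: power_mult_distrib binomial_gbinomial)

lemma binom_coeff_minus_one:
  "binom_coeff (- 1) n = (if n = 0 then 1 else if n = 1 then - 1 else 0)"
proof -
  have "(1 :: real) gchoose n = of_nat (1 choose n)" using binomial_gbinomial[of 1 n, where ?'a = real] by simp
  then show ?thesis by (cases n) (auto simp: binom_coeff_def binomial_eq_0)
qed

text \<open>By the asymptotics of generalized binomial coefficients the quotient by n^(s - 1)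
  converges, hence is bounded.\<close>

lemma binom_coeff_bound:
  obtains C where "0 < C" "\<And>n. 0 < n \<Longrightarrow> \<bar>binom_coeff s n\<bar> \<le> C * real n powr (s - 1)"
proof -
  have "convergent (\<lambda>n. (- s gchoose n) / ((-1)^n / exp ((- s + 1) * of_real (ln (real n)))))"
    using gbinomial_asymptotic[of "- s"] by (auto simp: convergent_def)
  then obtain C where C: "0 < C"
      "\<And>n. norm ((- s gchoose n) / ((-1)^n / exp ((- s + 1) * of_real (ln (real n))))) \<le> C"
    using convergent_imp_Bseq BseqE by blast
  show thesis
  proof (rule that[OF C(1)])
    fix n :: nat assume n: "0 < n"
    have "\<bar>binom_coeff s n\<bar> * exp ((1 - s) * ln (real n)) \<le> C"
      using C(2)[of n] by (simp add: binom_coeff_def abs_mult)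
    then have "\<bar>binom_coeff s n\<bar> * exp ((1 - s) * ln (real n)) * real n powr (s - 1) \<le>
        C * real n powr (s - 1)"
      by (rule mult_right_mono) simp
    moreover have "exp ((1 - s) * ln (real n)) * real n powr (s - 1) = 1"
      using n by (simp add: powr_def exp_add[symmetric] algebra_simps)
    ultimately show "\<bar>binom_coeff s n\<bar> \<le> C * real n powr (s - 1)"
      by (simp add: mult.assoc)
  qed
qed

text \<open>The terms are of order n^(s - 1 - e), with exponent below -1 because s < e. So h^(-s)
  can be applied to an element on which the powers of 1 - h decay fast enough.\<close>

lemma summable_binom_coeff_scaleR:
  fixes u :: "nat \<Rightarrow> 'a::real_normed_vector"
  assumes u: "\<And>n. 0 < n \<Longrightarrow> norm (u n) \<le> K * real n powr (- e)" and e: "s < e"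
  shows "summable (\<lambda>n. norm (binom_coeff s n *\<^sub>R u n))"
proof -
  obtain C where C: "0 < C" "\<And>n. 0 < n \<Longrightarrow> \<bar>binom_coeff s n\<bar> \<le> C * real n powr (s - 1)"
    using binom_coeff_bound by blast
  show ?thesis
  proof (rule summable_comparison_test')
    show "summable (\<lambda>n. C * K * real n powr (s - 1 - e))"
      using e by (intro summable_mult) (simp add: summable_real_powr_iff)
    fix n :: nat assume "1 \<le> n"
    then have n: "0 < n" by simp
    have "norm (binom_coeff s n *\<^sub>R u n) \<le> (C * real n powr (s - 1)) * (K * real n powr (- e))"
      using C(1) C(2)[OF n] u[OF n] by (auto intro!: mult_mono)
    also have "\<dots> = C * K * real n powr (s - 1 - e)"
      using n by (simp add: powr_add[symmetric] diff_conv_add_uminus del: add_uminus_conv_diff)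
    finally show "norm (norm (binom_coeff s n *\<^sub>R u n)) \<le> C * K * real n powr (s - 1 - e)" by simp
  qed
qed

text \<open>The binomial series of (1 - X)^(1/2) at a is dominated by a geometric series, and its
  Cauchy square has the coefficients of 1 - X. Real coefficients and continuity of the involution
  make the sum self-adjoint.\<close>

lemma sqrt_one_diff:
  fixes a :: "'a::unital_cstar_algebra"
  assumes a: "star a = a" "norm a < 1"
  obtains s where "star s = s" "s * s = 1 - a"
proof -
  let ?f = "\<lambda>n. binom_coeff (- (1/2)) n *\<^sub>R a ^ n"
  obtain C where C: "0 < C" "\<And>n. 0 < n \<Longrightarrow> \<bar>binom_coeff (- (1/2)) n\<bar> \<le> C * real n powr (- (1/2) - 1)"
    using binom_coeff_bound by blast
  have sm: "summable (\<lambda>n. norm (?f n))"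
  proof (rule summable_comparison_test')
    show "summable (\<lambda>n. C * norm a ^ n)" using a by (intro summable_mult summable_geometric) simp
    fix n :: nat assume n: "1 \<le> n"
    have "real n powr (- (1/2) - 1) \<le> 1" using n powr_mono[of "- (1/2) - 1" 0 "real n"] by simp
    then have "C * real n powr (- (1/2) - 1) \<le> C * 1" using C(1) by (intro mult_left_mono) auto
    with C(2)[of n] n have "\<bar>binom_coeff (- (1/2)) n\<bar> \<le> C" by linarith
    then show "norm (norm (?f n)) \<le> C * norm a ^ n"
      using C(1) by (auto intro!: mult_mono norm_power_le)
  qed
  define s where "s = suminf ?f"
  have s: "?f sums s" unfolding s_def by (rule summable_sums[OF summable_norm_cancel[OF sm]])
  have "(\<lambda>n. star (?f n)) sums star s" by (rule bounded_linear.sums[OF bounded_linear_star s])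
  moreover have "star (?f n) = ?f n" for n by (simp add: star_scaleR star_power a)
  ultimately have "star s = s" using s sums_unique2 by auto
  moreover have "s * s = 1 - a"
  proof -
    have "(\<lambda>n. \<Sum>i\<le>n. ?f i * ?f (n - i)) sums (s * s)"
      unfolding s_def by (rule Cauchy_product_sums[OF sm sm])
    moreover have "(\<Sum>i\<le>n. ?f i * ?f (n - i)) = binom_coeff (- 1) n *\<^sub>R a ^ n" for n
    proof -
      have "(\<Sum>i\<le>n. ?f i * ?f (n - i)) =
          (\<Sum>i\<le>n. (binom_coeff (- (1/2)) i * binom_coeff (- (1/2)) (n - i)) *\<^sub>R a ^ n)"
        by (intro sum.cong) (auto simp: power_add[symmetric])
      then show ?thesis
        using binom_coeff_convolution[of "- (1/2)" "- (1/2)" n] by (simp flip: scaleR_sum_left)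
    qed
    moreover have "(\<lambda>n. binom_coeff (- 1) n *\<^sub>R a ^ n) sums (\<Sum>n\<in>{0, 1}. binom_coeff (- 1) n *\<^sub>R a ^ n)"
      by (rule sums_finite) (auto simp: binom_coeff_minus_one)
    ultimately show ?thesis using sums_unique2 by (fastforce simp: binom_coeff_minus_one)
  qed
  ultimately show thesis by (rule that)
qed

text \<open>With \<open>q = s\<^sup>2 - 1 = - y\<^sup>*y\<close> and \<open>p = yy\<^sup>*\<close>, both \<open>q + 1\<close> and
  \<open>p + 1 = (yy\<^sup>* + y\<^sup>*y) + s\<^sup>2\<close> are positive. Since \<open>q(1 + q/N)\<^sup>2\<close> has the norm of
  \<open>p(1 - p/N)\<^sup>2\<close>, neither \<open>q(1 + q/N)\<^sup>2\<close> nor \<open>q(1 - q/N)\<^sup>2\<close> is much larger than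
  \<open>N = norm q\<close>, while their difference \<open>4q\<^sup>2/N\<close> has norm \<open>4N\<close>.\<close>
lemma norm_le_two_if_star_mult_self:
  fixes s y :: "'a::unital_cstar_algebra"
  assumes s: "star s = s" and y: "star y * y = 1 - s * s"
  shows "norm s \<le> 2"
proof (rule ccontr)
  define q where "q = s * s - 1"
  define p where "p = y * star y"
  define N where "N = norm q"
  assume "\<not> norm s \<le> 2"
  \<comment> \<open>The threshold 2 forces N > 3 > 1 + sqrt 2, a range in which 2 N^2 \<le> (N +
    1)^2 fails.\<close>
  then have "2 * 2 < norm s * norm s" by (intro mult_strict_mono) auto
  then have "4 < norm (s * s)" using norm_selfadjoint_square[OF s] by (simp add: power2_eq_square)
  also have "norm (s * s) \<le> N + 1"
    using norm_triangle_ineq[of q 1] norm_one_le[where 'a = 'a] by (simp add: q_def N_def)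
  finally have N: "3 < N" by simp
  have qy: "q = - (star y * y)" by (simp add: q_def y)
  have sq: "star q = q" by (simp add: qy star_minus star_mult star_star)
  have sp: "star p = p" by (simp add: p_def star_mult star_star)
  have Np: "norm p = N"
    by (simp add: p_def N_def qy norm_mult_star_self norm_star_mult_self)
  have np1: "norm (z + 1) \<le> N + 1" if "norm z = N" for z :: 'a
    using norm_triangle_ineq[of z 1] norm_one_le[where 'a = 'a] that by simp
  have "positive_elem (q + 1)" using positive_square[OF s] by (simp add: q_def)
  from positive_norm_le[OF this np1] have q_le: "norm (N *\<^sub>R 1 - q) \<le> N + 1"
    by (simp add: N_def algebra_simps)
  \<comment> \<open>Twice the real part of y and minus twice its imaginary part: half of c^2 + d^2
    is \<open>p + star y * y\<close>, which is thus positive by the case of self-adjoint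
    squares.\<close>
  define c where "c = y + star y"
  define d where "d = scaleC \<i> (y - star y)"
  have "star c = c" by (simp add: c_def star_add star_star)
  moreover have "star d = d"
    by (simp add: d_def star_scaleC star_diff star_star scaleC_diff_right scaleC_minus_left)
  ultimately have "positive_elem ((1/2) *\<^sub>R (c * c + d * d))"
    by (intro positive_scaleR positive_add positive_square) simp_all
  moreover have "d * d = - ((y - star y) * (y - star y))"
    by (simp add: d_def mult_scaleC_left mult_scaleC_right scaleC_i_i)
  then have "c * c + d * d = 2 *\<^sub>R (p + star y * y)"
    by (simp add: c_def p_def algebra_simps scaleR_2)
  then have "(1/2) *\<^sub>R (c * c + d * d) = p + star y * y" by simp
  ultimately have "positive_elem ((p + star y * y) + s * s)"
    using positive_square[OF s] by (intro positive_add[of "p + star y * y"]) simp_all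
  then have "positive_elem (p + 1)" by (simp add: y)
  from positive_norm_le[OF this np1[OF Np]] have p_le: "norm (N *\<^sub>R 1 - p) \<le> N + 1"
    by (simp add: algebra_simps)
  have sqN: "norm (u * u) \<le> (N + 1) * (N + 1)" if "norm u \<le> N + 1" for u :: 'a
    using that N by (intro order_trans[OF norm_mult_ineq] mult_mono) auto
  let ?a = "N *\<^sub>R 1 + q" and ?b = "N *\<^sub>R 1 - q" and ?r = "N *\<^sub>R 1 - p"
  have "star ?a = ?a" by (simp add: star_add star_scaleR sq)
  then have "star (y * ?a) * (y * ?a) = ?a * (star y * y) * ?a"
    by (simp only: star_mult mult.assoc)
  also have "star y * y = - q" by (simp add: qy)
  finally have "?a * q * ?a = - (star (y * ?a) * (y * ?a))" by simp
  \<comment> \<open>For u = y (N + q) the elements \<open>star u * u\<close> and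
    \<open>u * star u\<close> have equal norms; the intertwining y q = - p y then replaces q by -
    p.\<close>
  then have "norm (?a * q * ?a) = norm (y * ?a * star (y * ?a))"
    by (simp add: norm_mult_star_self norm_star_mult_self)
  also have "y * ?a = ?r * y" by (simp add: qy p_def algebra_simps)
  also have "?r * y * star (?r * y) = ?r * p * ?r"
    by (simp add: star_mult star_diff star_scaleR sp mult.assoc) (simp add: p_def mult.assoc)
  also have "\<dots> = p * (?r * ?r)" by (simp add: algebra_simps)
  also have "norm \<dots> \<le> N * ((N + 1) * (N + 1))"
    using N by (intro order_trans[OF norm_mult_ineq] mult_mono sqN p_le) (auto simp: Np)
  finally have A: "norm (?a * q * ?a) \<le> N * ((N + 1) * (N + 1))" .
  have B: "norm (q * (?b * ?b)) \<le> N * ((N + 1) * (N + 1))"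
    using N by (intro order_trans[OF norm_mult_ineq] mult_mono sqN q_le) (auto simp: N_def)
  have "?a * q * ?a - q * (?b * ?b) = (4 * N) *\<^sub>R (q * q)"
    by (simp add: algebra_simps flip: scaleR_add_left)
  then have "norm ((4 * N) *\<^sub>R (q * q)) \<le> norm (?a * q * ?a) + norm (q * (?b * ?b))"
    by (metis norm_triangle_ineq4)
  with A B have "4 * N * (N * N) \<le> 2 * (N * ((N + 1) * (N + 1)))"
    using N norm_selfadjoint_square[OF sq] by (simp add: N_def power2_eq_square)
  then have "N * (2 * (N * N)) \<le> N * ((N + 1) * (N + 1))" by (simp add: algebra_simps)
  then have "2 * (N * N) \<le> (N + 1) * (N + 1)" using N by simp
  moreover have "3 * N \<le> N * N" using N by (intro mult_right_mono) auto
  ultimately show False using N by (simp add: algebra_simps)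
qed

text \<open>The substitution \<open>s \<mapsto> 2s\<^sup>2 - 1\<close>, \<open>y \<mapsto> 2ys\<close> preserves the hypothesis and multiplies
  \<open>norm s - 1\<close> by at least 4, so the crude bound above improves to 1.\<close>
lemma norm_le_one_if_star_mult_self:
  fixes s y :: "'a::unital_cstar_algebra"
  assumes "star s = s" and "star y * y = 1 - s * s"
  shows "norm s \<le> 1"
proof -
  have "(norm s - 1) * 4 ^ k \<le> 1" for k
    using assms
  proof (induction k arbitrary: s y)
    case 0
    then show ?case using norm_le_two_if_star_mult_self[of s y] by simp
  next
    case (Suc k)
    \<comment> \<open>Modelled on the double angle formulas, with s = cos t and y = sin t.\<close>
    define s' where "s' = 2 *\<^sub>R (s * s) - 1"
    define y' where "y' = 2 *\<^sub>R (y * s)"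
    have "star s' = s'" by (simp add: s'_def star_diff star_scaleR star_mult Suc.prems)
    moreover have "star y' * y' = 4 *\<^sub>R (s * (star y * y) * s)"
      by (simp add: y'_def star_scaleR star_mult Suc.prems(1) mult.assoc)
    then have "star y' * y' = 1 - s' * s'"
      by (simp add: Suc.prems s'_def algebra_simps flip: scaleR_2)
    ultimately have IH: "(norm s' - 1) * 4 ^ k \<le> 1" by (rule Suc.IH)
    have "2 * (norm s)\<^sup>2 - 1 \<le> norm s'"
      using norm_triangle_ineq2[of "2 *\<^sub>R (s * s)" 1] norm_one_le[where 'a = 'a]
        norm_selfadjoint_square[OF Suc.prems(1)] by (simp add: s'_def)
    moreover have "4 * (norm s - 1) \<le> 2 * (norm s)\<^sup>2 - 2"
      using zero_le_power2[of "norm s - 1"] by (simp add: power2_eq_square algebra_simps)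
    ultimately have "(norm s - 1) * 4 \<le> norm s' - 1" by simp
    then have "(norm s - 1) * 4 * 4 ^ k \<le> (norm s' - 1) * 4 ^ k" by (intro mult_right_mono) auto
    also have "(norm s - 1) * 4 * 4 ^ k = (norm s - 1) * 4 ^ Suc k" by simp
    finally show ?case using IH by linarith
  qed
  show ?thesis
  proof (rule ccontr)
    assume "\<not> norm s \<le> 1"
    then have pos: "0 < norm s - 1" by simp
    obtain k where "1 / (norm s - 1) < 4 ^ k" using real_arch_pow[of 4 "1 / (norm s - 1)"] by auto
    then have "1 < (norm s - 1) * 4 ^ k" using pos by (simp add: field_simps)
    with \<open>(norm s - 1) * 4 ^ k \<le> 1\<close> show False by simp
  qed
qed

text \<open>After scaling, \<open>1 - star z * z\<close> has a self-adjoint square root s, and norm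
  s \<le> 1 by the preceding lemma. Then norm (s^2) \<le> 1 is the defining condition of positivity
  with t = 1.\<close>

theorem positive_star_mult_self: "positive_elem (star y * (y::'a::unital_cstar_algebra))"
proof -
  define r where "r = 1 + norm y"
  define z where "z = (1 / r) *\<^sub>R y"
  have r: "0 < r" by (simp add: r_def add_pos_nonneg)
  have sz: "star (star z * z) = star z * z" by (simp add: star_mult star_star)
  have "norm z < 1" using r by (simp add: z_def r_def)
  then have "norm (star z * z) < 1" by (simp add: norm_star_mult_self power_less_one_iff)
  then obtain s where s: "star s = s" "s * s = 1 - star z * z" using sqrt_one_diff[OF sz] by blast
  then have "norm s \<le> 1" by (intro norm_le_one_if_star_mult_self[of s z]) auto
  then have "norm (1 *\<^sub>R 1 - star z * z) \<le> 1"
    using norm_selfadjoint_square[OF s(1)] s(2) by (simp add: power_le_one)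
  then have "positive_elem (star z * z)" using sz unfolding positive_elem_def by blast
  then have "positive_elem ((r * r) *\<^sub>R (star z * z))" using r by (intro positive_scaleR) auto
  then show ?thesis using r by (simp add: z_def star_scaleR)
qed

text \<open>Each summand lies below the sum k, and k lies below norm k: the gap is norm k - k plus
  the other summands. The factor 3 is that of \<open>positive_bounded\<close>.\<close>

lemma norm_sq_le_norm_sum_star_mult:
  fixes y :: "'i \<Rightarrow> 'a::unital_cstar_algebra"
  assumes "finite I" "i \<in> I"
  shows "(norm (y i))\<^sup>2 \<le> 3 * norm (\<Sum>j\<in>I. star (y j) * y j)"
proof -
  define k where "k = (\<Sum>j\<in>I. star (y j) * y j)"
  have "positive_elem (norm k *\<^sub>R 1 - k)"
    by (rule positive_norm_diff) (simp_all add: k_def star_sum star_mult star_star)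
  then have "positive_elem ((norm k *\<^sub>R 1 - k) + (\<Sum>j\<in>I - {i}. star (y j) * y j))"
    by (intro positive_add positive_sum positive_star_mult_self)
  also have "(norm k *\<^sub>R 1 - k) + (\<Sum>j\<in>I - {i}. star (y j) * y j) = norm k *\<^sub>R 1 - star (y i) * y i"
    using sum.remove[OF assms, of "\<lambda>j. star (y j) * y j"] by (simp add: k_def)
  finally have "norm (star (y i) * y i) \<le> 3 * norm k"
    by (intro positive_bounded positive_star_mult_self) auto
  then show ?thesis by (simp add: norm_star_mult_self k_def)
qed

text \<open>The operator form of n t (1 - t)^n \<le> 1 on [0, 1], up to the factor 3. For g = 1 - h,
  the element 1 - g^n - n h g^n is 0 at n = 0 and grows at each step by (n + 1) h^2 g^n, a multiple
  of a self-adjoint square.\<close>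

lemma norm_mult_power_one_diff:
  fixes v :: "'i \<Rightarrow> 'a::unital_cstar_algebra" and I :: "'i set"
  defines "h \<equiv> \<Sum>i\<in>I. star (v i) * v i"
  assumes h1: "norm h < 1"
  shows "real n * norm (h * (1 - h) ^ n) \<le> 3"
proof -
  have sh: "star h = h" by (simp add: h_def star_sum star_mult star_star)
  obtain s where s: "star s = s" "s * s = 1 - h" using sqrt_one_diff[OF sh h1] by blast
  define g where "g = 1 - h"
  have g: "g = s * s" by (simp add: g_def s)
  have h_eq: "h = 1 - s * s" by (simp add: s)
  have "s * h = h * s" by (simp add: h_eq algebra_simps)
  then have hs: "s ^ m * h = h * s ^ m" for m by (rule power_commuting_commutes)
  have sn: "star (s ^ m) = s ^ m" for m by (simp add: star_power s)
  have gm: "g ^ m = s ^ m * s ^ m" for m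
    using power_mult[of s 2 m] by (simp add: g power2_eq_square mult_2 power_add)
  have "g * h = h * g" by (simp add: g_def algebra_simps)
  then have hg: "g ^ m * h = h * g ^ m" for m by (rule power_commuting_commutes)
  \<comment> \<open>Since g^m = s^m s^m, one factor s^m can be moved into the column on each side of
    h.\<close>
  have posh: "positive_elem (h * g ^ m)" for m
  proof -
    have "h * g ^ m = s ^ m * h * s ^ m" by (simp add: hs gm mult.assoc)
    also have "\<dots> = (\<Sum>i\<in>I. star (v i * s ^ m) * (v i * s ^ m))"
      by (simp add: h_def sum_distrib_left sum_distrib_right star_mult sn mult.assoc)
    finally show ?thesis by (simp add: positive_sum positive_star_mult_self)
  qed
  have "positive_elem (1 - g ^ n - real n *\<^sub>R (h * g ^ n))"
  proof (induction n)
    case (Suc n)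
    have "positive_elem (real (Suc n) *\<^sub>R ((h * s ^ n) * (h * s ^ n)))"
      by (intro positive_scaleR positive_square) (simp_all add: star_mult sn sh hs)
    with Suc have "positive_elem (1 - g ^ n - real n *\<^sub>R (h * g ^ n) +
        real (Suc n) *\<^sub>R ((h * s ^ n) * (h * s ^ n)))"
      by (rule positive_add)
    also have "(h * s ^ n) * (h * s ^ n) = h * (h * g ^ n)"
      by (metis gm hs mult.assoc)
    also have "1 - g ^ n - real n *\<^sub>R (h * g ^ n) + real (Suc n) *\<^sub>R (h * (h * g ^ n)) =
        1 - g ^ Suc n - real (Suc n) *\<^sub>R (h * g ^ Suc n)"
    proof -
      have "g ^ Suc n = g ^ n - h * g ^ n" by (simp add: g_def algebra_simps)
      then show ?thesis by (simp only:) (simp add: algebra_simps del: power_Suc)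
    qed
    finally show ?case .
  qed (simp add: positive_zero)
  then have "positive_elem ((1 - g ^ n - real n *\<^sub>R (h * g ^ n)) + g ^ n)"
    by (rule positive_add) (simp add: gm positive_square sn)
  then have "positive_elem (1 *\<^sub>R 1 - real n *\<^sub>R (h * g ^ n))" by (simp add: algebra_simps)
  then have "norm (real n *\<^sub>R (h * g ^ n)) \<le> 3 * 1"
    by (intro positive_bounded positive_scaleR posh) auto
  then show ?thesis by (simp add: g_def)
qed

section \<open>Factorization through a column\<close>

text \<open>For w = v h^(-15/32) and z = x h^(-1/16), the sum of \<open>star (w i) * w i\<close> is
  h^(1/16), and its product with z is x. As h may fail to be invertible, the powers are summed only
  against v and x: v (1 - h)^n is O(n^(-1/2)) and x (1 - h)^n is O(n^(-1/8)), while 15/32 < 1/2 and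
  1/16 < 1/8.\<close>

lemma cube_root_factorization:
  fixes v r :: "'i \<Rightarrow> 'a::unital_cstar_algebra" and I :: "'i set" and x :: 'a
  defines "h \<equiv> \<Sum>i\<in>I. star (v i) * v i"
  assumes I: "finite I" and h1: "norm h < 1"
    and x: "x * (star x * x) = (\<Sum>i\<in>I. r i * v i)"
  shows summable_fixed_column: "\<And>i. i \<in> I \<Longrightarrow>
      summable (\<lambda>n. norm (binom_coeff (15/32) n *\<^sub>R (v i * (1 - h) ^ n)))"
    and summable_root: "summable (\<lambda>n. norm (binom_coeff (1/16) n *\<^sub>R (x * (1 - h) ^ n)))"
    and factorization: "x = (\<Sum>n. binom_coeff (1/16) n *\<^sub>R (x * (1 - h) ^ n)) *
      (\<Sum>i\<in>I. star (\<Sum>n. binom_coeff (15/32) n *\<^sub>R (v i * (1 - h) ^ n)) *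
        (\<Sum>n. binom_coeff (15/32) n *\<^sub>R (v i * (1 - h) ^ n)))"
proof -
  define g where "g = 1 - h"
  have sh: "star h = h" by (simp add: h_def star_sum star_mult star_star)
  have sg: "star (g ^ n) = g ^ n" for n by (simp add: star_power g_def star_diff sh)
  have "g * h = h * g" by (simp add: g_def algebra_simps)
  then have gh: "g ^ n * h = h * g ^ n" for n by (rule power_commuting_commutes)
  have "positive_elem h" by (simp add: h_def positive_sum positive_star_mult_self)
  then have "norm g \<le> 1" using positive_norm_le[of h 1] h1 by (simp add: g_def)
  then have gn: "norm (g ^ n) \<le> 1" for n
    using norm_power_le[of g n] by (meson norm_ge_zero order_trans power_le_one)
  have decay_h: "norm (h * g ^ n) \<le> 3 * real n powr (- 1)" if "0 < n" for n
    using norm_mult_power_one_diff[of v I n] h1 that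
    by (simp add: h_def g_def powr_minus field_simps)
  have decay_v: "norm (v i * g ^ n) \<le> 3 * real n powr (- (1/2))" if i: "i \<in> I" and n: "0 < n" for i n
  proof (rule power2_le_imp_le)
    have "(norm (v i * g ^ n))\<^sup>2 \<le> 3 * norm (\<Sum>j\<in>I. star (v j * g ^ n) * (v j * g ^ n))"
      by (rule norm_sq_le_norm_sum_star_mult[OF I i])
    also have "(\<Sum>j\<in>I. star (v j * g ^ n) * (v j * g ^ n)) = g ^ n * h * g ^ n"
      by (simp add: h_def sum_distrib_left sum_distrib_right star_mult sg mult.assoc)
    also have "\<dots> = h * g ^ n * g ^ n" by (simp add: gh)
    also have "norm \<dots> \<le> norm (h * g ^ n) * 1"
      by (rule order_trans[OF norm_mult_ineq]) (intro mult_left_mono gn norm_ge_zero)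
    also have "\<dots> \<le> 3 * real n powr (- 1)" using decay_h[OF n] by simp
    finally show "(norm (v i * g ^ n))\<^sup>2 \<le> (3 * real n powr (- (1/2)))\<^sup>2"
      using n by (simp add: power_mult_distrib powr_power)
  qed simp
  define K where "K = norm x * (\<Sum>i\<in>I. norm (r i) * 3)"
  have K: "0 \<le> K" by (simp add: K_def sum_nonneg)
  \<comment> \<open>The C*-identity applied twice bounds the fourth power of the norm by
    \<open>norm x * norm (x * (star x * x) * g ^ n)\<close>, which is O(n^(-1/2)) through the column
    v; hence the exponent 1/8. The constant 1 + K serves because K \<le> (1 + K)^4.\<close>
  have decay_x: "norm (x * g ^ n) \<le> (1 + K) * real n powr (- (1/8))" if n: "0 < n" for n
  proof (rule power_le_imp_le_base)
    have "x * (star x * x) * g ^ n = (\<Sum>i\<in>I. r i * (v i * g ^ n))"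
      by (simp add: x sum_distrib_right mult.assoc)
    also have "norm \<dots> \<le> (\<Sum>i\<in>I. norm (r i) * (3 * real n powr (- (1/2))))"
    proof (rule order_trans[OF norm_sum], rule sum_mono)
      fix i assume "i \<in> I"
      then show "norm (r i * (v i * g ^ n)) \<le> norm (r i) * (3 * real n powr (- (1/2)))"
        by (intro order_trans[OF norm_mult_ineq mult_left_mono[OF decay_v[OF _ n]]]) auto
    qed
    finally have 1: "norm x * norm (x * (star x * x) * g ^ n) \<le> K * real n powr (- (1/2))"
      by (auto simp: K_def mult.assoc sum_distrib_right intro!: mult_left_mono)
    have star_norm: "(norm (u * g ^ n))\<^sup>2 \<le> norm (star u * u * g ^ n)" for u
    proof -
      have "(norm (u * g ^ n))\<^sup>2 = norm (g ^ n * (star u * u * g ^ n))"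
        by (simp add: star_mult sg mult.assoc flip: norm_star_mult_self)
      also have "\<dots> \<le> 1 * norm (star u * u * g ^ n)"
        by (rule order_trans[OF norm_mult_ineq]) (intro mult_right_mono gn norm_ge_zero)
      finally show ?thesis by simp
    qed
    have "norm (x * g ^ n) ^ Suc 3 = ((norm (x * g ^ n))\<^sup>2)\<^sup>2" by (simp flip: power_mult)
    also have "\<dots> \<le> (norm (star x * x * g ^ n))\<^sup>2"
      by (intro power_mono star_norm) simp
    also have "\<dots> \<le> norm (star x * (x * (star x * x) * g ^ n))"
      using star_norm[of "star x * x"] by (simp add: star_mult star_star mult.assoc)
    also have "\<dots> \<le> norm x * norm (x * (star x * x) * g ^ n)"
      using norm_mult_ineq[of "star x"] by simp
    also note 1
    also have "K \<le> (1 + K) ^ 4"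
      using K power_increasing[of 1 4 "1 + K"] by simp
    then have "K * real n powr (- (1/2)) \<le> (1 + K) ^ 4 * real n powr (- (1/2))"
      by (intro mult_right_mono) auto
    also have "\<dots> = ((1 + K) * real n powr (- (1/8))) ^ Suc 3"
      using n by (simp add: power_mult_distrib powr_power)
    finally show "norm (x * g ^ n) ^ Suc 3 \<le> ((1 + K) * real n powr (- (1/8))) ^ Suc 3" .
  qed (use K in simp)
  let ?w = "\<lambda>i n. binom_coeff (15/32) n *\<^sub>R (v i * g ^ n)"
  let ?z = "\<lambda>n. binom_coeff (1/16) n *\<^sub>R (x * g ^ n)"
  let ?h = "\<lambda>n. binom_coeff (15/16) n *\<^sub>R (h * g ^ n)"
  have w: "summable (\<lambda>n. norm (?w i n))" if "i \<in> I" for i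
    by (rule summable_binom_coeff_scaleR[OF decay_v[OF that]]) auto
  have z: "summable (\<lambda>n. norm (?z n))"
    by (rule summable_binom_coeff_scaleR[OF decay_x]) auto
  have hs: "summable (\<lambda>n. norm (?h n))"
    by (rule summable_binom_coeff_scaleR[OF decay_h]) auto
  define H where "H = (\<Sum>i\<in>I. star (\<Sum>n. ?w i n) * (\<Sum>n. ?w i n))"
  \<comment> \<open>Cauchy products of the series for w with its adjoint. Since g commutes with h,
    the two exponents 15/32 add up to 15/16, and H is the series for h h^(-15/16).\<close>
  have "(\<lambda>n. \<Sum>i\<in>I. \<Sum>k\<le>n. star (?w i k) * ?w i (n - k)) sums H"
    unfolding H_def
  proof (rule sums_sum)
    fix i assume i: "i \<in> I"
    have "star (\<Sum>n. ?w i n) = (\<Sum>n. star (?w i n))"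
      by (rule bounded_linear.suminf[OF bounded_linear_star summable_norm_cancel[OF w[OF i]]])
    then show "(\<lambda>n. \<Sum>k\<le>n. star (?w i k) * ?w i (n - k)) sums
        (star (\<Sum>n. ?w i n) * (\<Sum>n. ?w i n))"
      using Cauchy_product_sums[of "\<lambda>n. star (?w i n)" "?w i"] w[OF i] by simp
  qed
  moreover have "(\<Sum>i\<in>I. \<Sum>k\<le>n. star (?w i k) * ?w i (n - k)) = ?h n" for n
  proof -
    have "(\<Sum>i\<in>I. \<Sum>k\<le>n. star (?w i k) * ?w i (n - k)) =
        (\<Sum>k\<le>n. (binom_coeff (15/32) k * binom_coeff (15/32) (n - k)) *\<^sub>R (g ^ k * h * g ^ (n - k)))"
      by (subst sum.swap)
         (simp add: h_def star_scaleR star_mult sg mult.assoc scaleR_sum_right sum_distrib_left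
           sum_distrib_right mult.commute)
    also have "\<dots> = (\<Sum>k\<le>n. (binom_coeff (15/32) k * binom_coeff (15/32) (n - k)) *\<^sub>R (h * g ^ n))"
      by (intro sum.cong) (auto simp: gh mult.assoc simp flip: power_add)
    finally show ?thesis
      using binom_coeff_convolution[of "15/32" "15/32" n] by (simp flip: scaleR_sum_left)
  qed
  ultimately have "?h sums H" by simp
  then have H: "H = suminf ?h" by (rule sums_unique)
  have "(\<lambda>n. \<Sum>k\<le>n. ?z k * ?h (n - k)) sums (suminf ?z * H)"
    unfolding H by (rule Cauchy_product_sums[OF z hs])
  \<comment> \<open>The exponents 1/16 and 15/16 add up to 1 and all coefficients of (1 - X)^(-1)
    are 1. The resulting terms x h g^n telescope, with sum x because x g^n tends to 0.\<close>
  moreover have "(\<Sum>k\<le>n. ?z k * ?h (n - k)) = x * g ^ n - x * g ^ Suc n" for n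
  proof -
    have "(\<Sum>k\<le>n. ?z k * ?h (n - k)) =
        (\<Sum>k\<le>n. (binom_coeff (1/16) k * binom_coeff (15/16) (n - k)) *\<^sub>R (x * (g ^ k * h * g ^ (n - k))))"
      by (simp add: mult.assoc mult.commute)
    also have "\<dots> = (\<Sum>k\<le>n. (binom_coeff (1/16) k * binom_coeff (15/16) (n - k)) *\<^sub>R (x * (h * g ^ n)))"
      by (intro sum.cong) (auto simp: gh mult.assoc simp flip: power_add)
    also have "\<dots> = x * (h * g ^ n)"
      using binom_coeff_convolution[of "1/16" "15/16" n] by (simp add: binom_coeff_one flip: scaleR_sum_left)
    finally show ?thesis by (simp add: g_def algebra_simps)
  qed
  ultimately have "(\<lambda>n. x * g ^ n - x * g ^ Suc n) sums (suminf ?z * H)" by simp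
  moreover have "(\<lambda>n. x * g ^ n) \<longlonglongrightarrow> 0"
  proof (rule Lim_null_comparison)
    show "\<forall>\<^sub>F n in sequentially. norm (x * g ^ n) \<le> (1 + K) * real n powr (- (1/8))"
      using decay_x by (auto intro!: eventually_sequentiallyI[of 1])
    have "(\<lambda>n. (1 + K) * real n powr (- (1/8))) \<longlonglongrightarrow> (1 + K) * 0"
      by (intro tendsto_intros tendsto_neg_powr filterlim_real_sequentially) auto
    then show "(\<lambda>n. (1 + K) * real n powr (- (1/8))) \<longlonglongrightarrow> 0" by simp
  qed
  then have "(\<lambda>n. x * g ^ n - x * g ^ Suc n) sums (x * g ^ 0 - 0)"
    by (rule telescope_sums')
  ultimately have "x = suminf ?z * H" using sums_unique2 by fastforce
  then show "x = (\<Sum>n. binom_coeff (1/16) n *\<^sub>R (x * (1 - h) ^ n)) *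
      (\<Sum>i\<in>I. star (\<Sum>n. binom_coeff (15/32) n *\<^sub>R (v i * (1 - h) ^ n)) *
        (\<Sum>n. binom_coeff (15/32) n *\<^sub>R (v i * (1 - h) ^ n)))"
    unfolding H_def g_def .
  show "summable (\<lambda>n. norm (binom_coeff (15/32) n *\<^sub>R (v i * (1 - h) ^ n)))" if "i \<in> I" for i
    using w[OF that] unfolding g_def .
  show "summable (\<lambda>n. norm (binom_coeff (1/16) n *\<^sub>R (x * (1 - h) ^ n)))"
    using z unfolding g_def .
qed

section \<open>The multiplier algebra\<close>

text \<open>Nondegeneracy of the inner product \<open>star x * y\<close>: testing with y = u - v
  gives \<open>star y * y = 0\<close>.\<close>

lemma star_mult_cancel:
  fixes u v :: "'a::cstar_algebra"
  assumes "\<And>y. star u * y = star v * y"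
  shows "u = v"
proof -
  have "star (u - v) * (u - v) = 0" using assms[of "u - v"] by (simp add: star_diff algebra_simps)
  then show ?thesis using norm_star_mult_self[of "u - v"] by simp
qed

lemma bounded_linear_scaleC: "bounded_linear (scaleC c :: 'a::cstar_algebra \<Rightarrow> 'a)"
proof (rule bounded_linear_intro[where K = "cmod c"])
  show "scaleC c (r *\<^sub>R x) = r *\<^sub>R scaleC c x" for r and x :: 'a
    by (simp add: scaleC_scaleC mult.commute flip: scaleC_of_real)
qed (simp_all add: scaleC_add_right norm_scaleC mult.commute)

text \<open>The left action and its adjoint for the \<open>A\<close>-valued inner product \<open>x\<^sup>*y\<close> on \<open>A\<close>. This serves as
  a unitization: if \<open>A\<close> has a unit then the multiplier algebra is \<open>A\<close> itself.\<close>
typedef (overloaded) 'a multiplier =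
  "{p :: ('a::cstar_algebra \<Rightarrow>\<^sub>L 'a) \<times> ('a \<Rightarrow>\<^sub>L 'a).
      \<forall>x y. star (blinfun_apply (fst p) x) * y = star x * blinfun_apply (snd p) y}"
  by (rule exI[of _ 0]) simp

definition mact :: "'a::cstar_algebra multiplier \<Rightarrow> 'a \<Rightarrow>\<^sub>L 'a" where
  "mact m = fst (Rep_multiplier m)"

definition madj :: "'a::cstar_algebra multiplier \<Rightarrow> 'a \<Rightarrow>\<^sub>L 'a" where
  "madj m = snd (Rep_multiplier m)"

lemma star_mact: "star (mact m x) * y = star x * madj m y"
  using Rep_multiplier[of m] by (auto simp: mact_def madj_def split_beta)

lemma star_madj: "star (madj m x) * y = star x * mact m y"
  using arg_cong[OF star_mact[of m y x], of star] by (simp add: star_mult star_star)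

lemma mact_madj_Abs:
  assumes "\<And>x y. star (blinfun_apply L x) * y = star x * blinfun_apply L' y"
  shows "mact (Abs_multiplier (L, L')) = L" "madj (Abs_multiplier (L, L')) = L'"
  using assms by (simp_all add: mact_def madj_def Abs_multiplier_inverse)

text \<open>By nondegeneracy the action determines its adjoint, so identities of multipliers can be
  checked on the action alone.\<close>

lemma multiplier_eqI:
  assumes "\<And>x. mact m x = mact n x"
  shows "m = n"
proof -
  have eq: "mact m = mact n" by (rule blinfun_eqI) (rule assms)
  have "madj m x = madj n x" for x
    by (rule star_mult_cancel) (simp add: star_madj eq)
  then have "madj m = madj n" by (rule blinfun_eqI)
  with eq have "Rep_multiplier m = Rep_multiplier n" by (simp add: mact_def madj_def prod_eq_iff)
  then show ?thesis by (simp add: Rep_multiplier_inject)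
qed

text \<open>The typedef speaks of real-linear maps; the adjoint relation forces compatibility with
  complex scalars here and with right multiplication in \<open>mact_mult\<close>.\<close>

lemma mact_scaleC: "mact m (scaleC c x) = scaleC c (mact m x)"
  by (rule star_mult_cancel)
     (simp add: star_mact star_scaleC mult_scaleC_left)

lemma mact_mult: "mact m (x * y) = mact m x * y"
  by (rule star_mult_cancel)
     (simp add: star_mact star_mult mult.assoc)

instantiation multiplier :: (cstar_algebra) real_normed_algebra
begin

definition "0 = Abs_multiplier (0, 0)"
definition "m + n = Abs_multiplier (mact m + mact n, madj m + madj n)"
definition "- m = Abs_multiplier (- mact m, - madj m)"
definition "m - n = Abs_multiplier (mact m - mact n, madj m - madj n)"
definition "m * n = Abs_multiplier (mact m o\<^sub>L mact n, madj n o\<^sub>L madj m)"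
definition "r *\<^sub>R m = Abs_multiplier (r *\<^sub>R mact m, r *\<^sub>R madj m)"
definition "norm m = norm (mact m)"
definition "sgn m = scaleR (inverse (norm m)) (m :: 'a multiplier)"
definition "dist m n = norm (m - n :: 'a multiplier)"
definition [code del]: "(uniformity :: ('a multiplier \<times> 'a multiplier) filter) =
  (INF e\<in>{0 <..}. principal {(x, y). dist x y < e})"
definition [code del]: "open U \<longleftrightarrow>
  (\<forall>x\<in>U. eventually (\<lambda>(x', y). x' = x \<longrightarrow> y \<in> U) (uniformity :: ('a multiplier \<times> 'a multiplier) filter))"

lemma mact_zero: "mact (0::'a multiplier) = 0"
  unfolding zero_multiplier_def by (rule mact_madj_Abs) simp

lemma mact_add: "mact (m + n :: 'a multiplier) = mact m + mact n"
  and madj_add: "madj (m + n :: 'a multiplier) = madj m + madj n"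
  unfolding plus_multiplier_def
  by (rule mact_madj_Abs; simp add: blinfun.add_left star_add star_mact algebra_simps)+

lemma mact_minus: "mact (- m :: 'a multiplier) = - mact m"
  unfolding uminus_multiplier_def
  by (rule mact_madj_Abs) (simp add: blinfun.minus_left star_minus star_mact)

lemma mact_diff: "mact (m - n :: 'a multiplier) = mact m - mact n"
  and madj_diff: "madj (m - n :: 'a multiplier) = madj m - madj n"
  unfolding minus_multiplier_def
  by (rule mact_madj_Abs; simp add: blinfun.diff_left star_diff star_mact algebra_simps)+

lemma mact_times: "mact (m * n :: 'a multiplier) = mact m o\<^sub>L mact n"
  and madj_times: "madj (m * n :: 'a multiplier) = madj n o\<^sub>L madj m"
  unfolding times_multiplier_def
  by (rule mact_madj_Abs; simp add: star_mact)+

lemma mact_scaleR: "mact (r *\<^sub>R m :: 'a multiplier) = r *\<^sub>R mact m"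
  unfolding scaleR_multiplier_def
  by (rule mact_madj_Abs) (simp add: blinfun.scaleR_left star_scaleR star_mact)

instance
proof
  fix a b c :: "'a multiplier" and r s :: real
  show "dist a b = norm (a - b)" by (rule dist_multiplier_def)
  show "uniformity = (INF e\<in>{0 <..}. principal {(x, y :: 'a multiplier). dist x y < e})"
    by (rule uniformity_multiplier_def)
  show "open U \<longleftrightarrow> (\<forall>x\<in>U. \<forall>\<^sub>F (x', y) in uniformity. x' = x \<longrightarrow> y \<in> U)" for U :: "'a multiplier set"
    by (rule open_multiplier_def)
  show "norm a = 0 \<longleftrightarrow> a = 0"
    by (auto simp: norm_multiplier_def mact_zero intro: multiplier_eqI)
  show "norm (a + b) \<le> norm a + norm b"
    by (simp add: norm_multiplier_def mact_add norm_triangle_ineq)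
  show "norm (r *\<^sub>R a) = \<bar>r\<bar> * norm a" by (simp add: norm_multiplier_def mact_scaleR)
  show "norm (a * b) \<le> norm a * norm b"
    by (simp add: norm_multiplier_def mact_times norm_blinfun_compose)
qed (rule sgn_multiplier_def |
    (rule multiplier_eqI; simp add: mact_zero mact_add mact_minus mact_diff mact_times mact_scaleR
      blinfun.bilinear_simps algebra_simps))+

end

instantiation multiplier :: (cstar_algebra) unital_cstar_algebra
begin

definition "1 = Abs_multiplier (id_blinfun, id_blinfun)"
definition "star m = Abs_multiplier (madj m, mact m)"
definition "scaleC c m =
  Abs_multiplier (Blinfun (scaleC c) o\<^sub>L mact m, Blinfun (scaleC (cnj c)) o\<^sub>L madj m)"

lemma mact_one: "mact (1::'a multiplier) = id_blinfun"
  unfolding one_multiplier_def by (rule mact_madj_Abs) simp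

lemma mact_star: "mact (star m :: 'a multiplier) = madj m"
  and madj_star: "madj (star m :: 'a multiplier) = mact m"
  unfolding star_multiplier_def by (rule mact_madj_Abs; simp add: star_madj)+

lemma mact_scaleC_multiplier: "mact (scaleC c m :: 'a multiplier) x = scaleC c (mact m x)"
  and madj_scaleC_multiplier: "madj (scaleC c m :: 'a multiplier) x = scaleC (cnj c) (madj m x)"
proof -
  have "star (blinfun_apply (Blinfun (scaleC c) o\<^sub>L mact m) x) * y =
      star x * blinfun_apply (Blinfun (scaleC (cnj c)) o\<^sub>L madj m) y" for x y
    by (simp add: bounded_linear_Blinfun_apply[OF bounded_linear_scaleC] star_scaleC star_mact
        mult_scaleC_left mult_scaleC_right)
  from mact_madj_Abs[OF this]
  show "mact (scaleC c m) x = scaleC c (mact m x)"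
    and "madj (scaleC c m) x = scaleC (cnj c) (madj m x)"
    by (simp_all add: scaleC_multiplier_def bounded_linear_Blinfun_apply[OF bounded_linear_scaleC])
qed

text \<open>Moving m across the inner product turns norm (m x) ^2 into the norm of
  \<open>star x * mact (star m * m) x\<close>. The reverse inequality follows once the involution is
  known to be isometric.\<close>

lemma norm_sq_le_norm_star_mult: "(norm (m :: 'a multiplier))\<^sup>2 \<le> norm (star m * m)"
proof -
  have "norm m \<le> sqrt (norm (star m * m))"
    unfolding norm_multiplier_def[of m]
  proof (rule norm_blinfun_bound)
    fix x
    have "(norm (mact m x))\<^sup>2 = norm (star x * mact (star m * m) x)"
      by (simp add: star_mact mact_times mact_star flip: norm_star_mult_self)
    also have "\<dots> \<le> norm x * (norm (star m * m) * norm x)"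
      unfolding norm_multiplier_def[of "star m * m"]
      by (rule order_trans[OF norm_mult_ineq]) (simp add: mult_left_mono norm_blinfun)
    also have "\<dots> = (sqrt (norm (star m * m)) * norm x)\<^sup>2"
      by (simp add: power_mult_distrib power2_eq_square)
    finally show "norm (mact m x) \<le> sqrt (norm (star m * m)) * norm x"
      by (rule power2_le_imp_le) simp
  qed simp
  then show ?thesis by (metis norm_ge_zero real_le_rsqrt real_sqrt_ge_0_iff real_sqrt_pow2 power_mono)
qed

lemma norm_star_multiplier: "norm (star (m :: 'a multiplier)) = norm m"
proof -
  have le: "norm n \<le> norm (star n)" for n :: "'a multiplier"
  proof (cases "n = 0")
    case False
    have "norm n * norm n \<le> norm (star n) * norm n"
      using norm_sq_le_norm_star_mult[of n] norm_mult_ineq[of "star n" n]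
      by (simp add: power2_eq_square)
    with False show ?thesis by simp
  qed simp
  have "star (star m) = m" by (rule multiplier_eqI) (simp add: mact_star madj_star)
  with le[of m] le[of "star m"] show ?thesis by simp
qed

instance
proof
  fix a b :: "'a multiplier" and c d :: complex and r :: real
  show "1 * a = a" "a * 1 = a" by (rule multiplier_eqI; simp add: mact_times mact_one)+
  show "scaleC c (a + b) = scaleC c a + scaleC c b"
    by (rule multiplier_eqI)
       (simp add: mact_scaleC_multiplier mact_add blinfun.add_left scaleC_add_right)
  show "scaleC (c + d) a = scaleC c a + scaleC d a"
    by (rule multiplier_eqI)
       (simp add: mact_scaleC_multiplier mact_add blinfun.add_left scaleC_add_left)
  show "scaleC c (scaleC d a) = scaleC (c * d) a"
    by (rule multiplier_eqI) (simp add: mact_scaleC_multiplier scaleC_scaleC)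
  show "scaleC (complex_of_real r) a = r *\<^sub>R a"
    by (rule multiplier_eqI)
       (simp add: mact_scaleC_multiplier mact_scaleR blinfun.scaleR_left scaleC_of_real)
  show "scaleC c a * b = scaleC c (a * b)"
    by (rule multiplier_eqI) (simp add: mact_scaleC_multiplier mact_times)
  show "a * scaleC c b = scaleC c (a * b)"
    by (rule multiplier_eqI) (simp add: mact_scaleC_multiplier mact_times mact_scaleC)
  show "star (a + b) = star a + star b"
    by (rule multiplier_eqI) (simp add: mact_star mact_add madj_add blinfun.add_left)
  show "star (scaleC c a) = scaleC (cnj c) (star a)"
    by (rule multiplier_eqI) (simp add: mact_star mact_scaleC_multiplier madj_scaleC_multiplier)
  show "star (a * b) = star b * star a"
    by (rule multiplier_eqI) (simp add: mact_star mact_times madj_times)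
  show "star (star a) = a"
    by (rule multiplier_eqI) (simp add: mact_star madj_star)
  have "norm (star a * a) \<le> (norm a)\<^sup>2"
    using norm_mult_ineq[of "star a" a] by (simp add: norm_star_multiplier power2_eq_square)
  with norm_sq_le_norm_star_mult[of a] show "norm (star a * a) = (norm a)\<^sup>2" by simp
  show "norm (scaleC c a) = cmod c * norm a"
  proof -
    have le: "norm (scaleC d m) \<le> cmod d * norm m" for d and m :: "'a multiplier"
      unfolding norm_multiplier_def
    proof (rule norm_blinfun_bound)
      fix x
      have "norm (mact (scaleC d m) x) = cmod d * norm (mact m x)"
        by (simp add: mact_scaleC_multiplier norm_scaleC)
      also have "\<dots> \<le> cmod d * (norm (mact m) * norm x)"
        by (intro mult_left_mono norm_blinfun) simp
      finally show "norm (mact (scaleC d m) x) \<le> cmod d * norm (mact m) * norm x"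
        by (simp add: mult.assoc)
    qed simp
    show ?thesis
    proof (cases "c = 0")
      case True
      then show ?thesis using le[of c a] by simp
    next
      case False
      have "scaleC (1 / c) (scaleC c a) = a"
        by (rule multiplier_eqI)
           (use False scaleC_of_real[of 1] in \<open>simp add: mact_scaleC_multiplier scaleC_scaleC\<close>)
      with le[of "1 / c" "scaleC c a"] have "cmod c * norm a \<le> norm (scaleC c a)"
        using False by (simp add: norm_divide field_simps)
      with le[of c a] show ?thesis by simp
    qed
  qed
next
  fix X :: "nat \<Rightarrow> 'a multiplier"
  assume X: "Cauchy X"
  have "Cauchy (\<lambda>n. mact (X n))"
    using X by (simp add: Cauchy_def dist_norm norm_multiplier_def mact_diff)
  then obtain L where L: "(\<lambda>n. mact (X n)) \<longlonglongrightarrow> L" using Cauchy_convergent_iff convergent_def by blast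
  \<comment> \<open>Isometry makes the adjoints Cauchy too; the adjoint relation passes to the two
    limits, so they form a multiplier.\<close>
  have "norm (madj m) = norm m" for m :: "'a multiplier"
    using norm_star_multiplier[of m] by (simp add: norm_multiplier_def mact_star)
  then have "Cauchy (\<lambda>n. madj (X n))"
    using X by (simp add: Cauchy_def dist_norm flip: madj_diff)
  then obtain L' where L': "(\<lambda>n. madj (X n)) \<longlonglongrightarrow> L'" using Cauchy_convergent_iff convergent_def by blast
  have "star (blinfun_apply L x) * y = star x * blinfun_apply L' y" for x y
  proof (rule LIMSEQ_unique)
    show "(\<lambda>n. star (mact (X n) x) * y) \<longlonglongrightarrow> star (blinfun_apply L x) * y"
      by (intro tendsto_intros bounded_linear.tendsto[OF bounded_linear_star] L)
    show "(\<lambda>n. star (mact (X n) x) * y) \<longlonglongrightarrow> star x * blinfun_apply L' y"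
      unfolding star_mact by (intro tendsto_intros L')
  qed
  from mact_madj_Abs(1)[OF this] have "(\<lambda>n. mact (X n)) \<longlonglongrightarrow> mact (Abs_multiplier (L, L'))"
    using L by simp
  then have "X \<longlonglongrightarrow> Abs_multiplier (L, L')"
    by (simp add: LIMSEQ_def dist_norm norm_multiplier_def mact_diff)
  then show "convergent X" by (auto simp: convergent_def)
qed

end

section \<open>The algebra as an ideal of its multiplier algebra\<close>

definition left_mult :: "'a::cstar_algebra \<Rightarrow> 'a multiplier" where
  "left_mult a = Abs_multiplier (blinfun_mult_right a, blinfun_mult_right (star a))"

lemma mact_left_mult [simp]: "mact (left_mult a) x = a * x"
  using mact_madj_Abs(1)[of "blinfun_mult_right a" "blinfun_mult_right (star a)"]
  by (simp add: left_mult_def star_mult mult.assoc)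

lemma madj_left_mult [simp]: "madj (left_mult a) x = star a * x"
  using mact_madj_Abs(2)[of "blinfun_mult_right a" "blinfun_mult_right (star a)"]
  by (simp add: left_mult_def star_mult mult.assoc)

lemma left_mult_add: "left_mult (a + b) = left_mult a + left_mult b"
  by (rule multiplier_eqI) (simp add: mact_add blinfun.add_left algebra_simps)

lemma left_mult_scaleR: "left_mult (r *\<^sub>R a) = r *\<^sub>R left_mult a"
  by (rule multiplier_eqI) (simp add: mact_scaleR blinfun.scaleR_left)

lemma left_mult_mult: "left_mult (a * b) = left_mult a * left_mult b"
  by (rule multiplier_eqI) (simp add: mact_times mult.assoc)

lemma left_mult_star: "left_mult (star a) = star (left_mult a)"
  by (rule multiplier_eqI) (simp add: mact_star)

text \<open>Together with \<open>left_mult_mult_multiplier\<close>, its adjoint version, this makes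
  A a two-sided ideal of its multiplier algebra.\<close>

lemma mult_left_mult: "m * left_mult a = left_mult (mact m a)"
  by (rule multiplier_eqI) (simp add: mact_times mact_mult)

lemma left_mult_mult_multiplier: "left_mult a * m = left_mult (star (madj m (star a)))"
  using arg_cong[OF mult_left_mult[of "star m" "star a"], of star]
  by (simp add: star_mult star_star left_mult_star mact_star)

lemma norm_left_mult: "norm (left_mult a) = norm (a::'a::cstar_algebra)"
proof (rule antisym)
  show "norm (left_mult a) \<le> norm a"
    unfolding norm_multiplier_def by (rule norm_blinfun_bound) (simp_all add: norm_mult_ineq)
  have "norm a * norm a = norm (mact (left_mult a) (star a))"
    by (simp add: norm_mult_star_self power2_eq_square)
  also have "\<dots> \<le> norm (left_mult a) * norm a"
    using norm_blinfun[of "mact (left_mult a)" "star a"] by (simp add: norm_multiplier_def)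
  finally show "norm a \<le> norm (left_mult a)" by (cases "a = 0") auto
qed

lemma bounded_linear_left_mult: "bounded_linear left_mult"
  by (rule bounded_linear_intro[where K = 1])
     (simp_all add: left_mult_add left_mult_scaleR norm_left_mult)

lemma left_mult_sum: "left_mult (\<Sum>i\<in>I. f i) = (\<Sum>i\<in>I. left_mult (f i))"
  using bounded_linear_left_mult by (intro linear_sum bounded_linear.linear)

lemma left_mult_inj: "left_mult a = left_mult b \<longleftrightarrow> a = b"
proof
  assume "left_mult a = left_mult b"
  then have "left_mult (a - b) = 0"
    using linear_diff[OF bounded_linear.linear[OF bounded_linear_left_mult], of a b] by simp
  then show "a = b" using norm_left_mult[of "a - b"] by simp
qed simp

text \<open>The embedding is isometric and A is complete, so absolutely convergent series of
  elements of A have their sums in A.\<close>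

lemma suminf_in_range_left_mult:
  assumes "\<And>n. f n \<in> range left_mult" and sm: "summable (\<lambda>n. norm (f n))"
  shows "suminf f \<in> range left_mult"
proof -
  define a where "a n = inv_into UNIV left_mult (f n)" for n
  have a: "f n = left_mult (a n)" for n by (simp add: a_def f_inv_into_f assms(1))
  with sm have "summable a" by (intro summable_norm_cancel[of a]) (simp add: a norm_left_mult)
  then have "left_mult (suminf a) = suminf f"
    using bounded_linear.suminf[OF bounded_linear_left_mult, of a] by (simp flip: a)
  then show ?thesis by (metis rangeI)
qed

text \<open>The multiplier algebra provides 1 - h, and the series for w and z stay in A because A is
  an ideal. The power of h acts on v from the right and e from the left, so w inherits v = e v. The
  coefficients y are \<open>z * star (w i)\<close>.\<close>

theorem factorization_through_fixed_column:
  fixes v r :: "'i \<Rightarrow> 'a::cstar_algebra" and e :: "'i \<Rightarrow> 'i \<Rightarrow> 'a"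
  assumes I: "finite I" and x: "x * (star x * x) = (\<Sum>i\<in>I. r i * v i)"
    and v: "\<And>i. i \<in> I \<Longrightarrow> v i = (\<Sum>j\<in>I. e i j * v j)"
  obtains y w where "x = (\<Sum>i\<in>I. y i * w i)"
    and "\<And>i. i \<in> I \<Longrightarrow> w i = (\<Sum>j\<in>I. e i j * w j)"
proof -
  let ?h = "\<Sum>i\<in>I. star (left_mult (v i)) * left_mult (v i)"
  \<comment> \<open>Dividing v and multiplying r by k preserves the products r v and the relation v
    = e v, and brings norm h = norm \<open>?h\<close> / k^2 below 1.\<close>
  define k where "k = 1 + norm ?h"
  have k: "1 \<le> k" by (simp add: k_def)
  define V where "V i = left_mult ((1 / k) *\<^sub>R v i)" for i
  define R where "R i = left_mult (k *\<^sub>R r i)" for i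
  define X where "X = left_mult x"
  define h where "h = (\<Sum>i\<in>I. star (V i) * V i)"
  have "h = (1 / (k * k)) *\<^sub>R ?h"
    by (simp add: h_def V_def left_mult_scaleR star_scaleR scaleR_sum_right)
  then have "norm h = norm ?h / (k * k)" using k by simp
  also have "norm ?h < k * k" using k mult_left_mono[of 1 k k] by (simp add: k_def)
  then have "norm ?h / (k * k) < 1" using k by simp
  finally have h1: "norm h < 1" .
  have X: "X * (star X * X) = (\<Sum>i\<in>I. R i * V i)"
    using arg_cong[OF x, of left_mult] k
    by (simp add: X_def R_def V_def left_mult_mult left_mult_star left_mult_sum left_mult_scaleR)
  let ?w = "\<lambda>i n. binom_coeff (15/32) n *\<^sub>R (V i * (1 - h) ^ n)"
  let ?z = "\<lambda>n. binom_coeff (1/16) n *\<^sub>R (X * (1 - h) ^ n)"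
  note fact = cube_root_factorization[where v = V and r = R, OF I h1[unfolded h_def] X, folded h_def]
  have rng: "c *\<^sub>R (left_mult a * m) \<in> range left_mult" for c a and m :: "'a multiplier"
    by (simp add: left_mult_mult_multiplier flip: left_mult_scaleR)
  have "suminf (?w i) \<in> range left_mult" if "i \<in> I" for i
    using fact(1)[OF that] unfolding V_def by (rule suminf_in_range_left_mult[OF rng])
  then have "suminf (?w i) = left_mult (inv_into UNIV left_mult (suminf (?w i)))" if "i \<in> I" for i
    by (rule f_inv_into_f[symmetric]) (rule that)
  moreover define w where "w i = inv_into UNIV left_mult (suminf (?w i))" for i
  ultimately have w: "suminf (?w i) = left_mult (w i)" if "i \<in> I" for i
    using that by simp
  obtain z where z: "suminf ?z = left_mult z"
    using suminf_in_range_left_mult[OF rng fact(2)[unfolded X_def]] unfolding X_def by blast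
  show thesis
  proof (rule that[of "\<lambda>i. z * star (w i)" w])
    have "left_mult x = left_mult (\<Sum>i\<in>I. z * star (w i) * w i)"
      using fact(3) unfolding z X_def[symmetric]
      by (simp add: w left_mult_sum left_mult_mult left_mult_star sum_distrib_left mult.assoc)
    then show "x = (\<Sum>i\<in>I. z * star (w i) * w i)" by (simp add: left_mult_inj)
    fix i assume i: "i \<in> I"
    have sums: "?w j sums left_mult (w j)" if "j \<in> I" for j
      using summable_sums[OF summable_norm_cancel[OF fact(1)[OF that]]] w[OF that] by simp
    have "(\<lambda>n. \<Sum>j\<in>I. left_mult (e i j) * ?w j n) sums (\<Sum>j\<in>I. left_mult (e i j) * left_mult (w j))"
      by (intro sums_sum sums_mult sums)
    moreover have "(\<Sum>j\<in>I. left_mult (e i j) * ?w j n) = ?w i n" for n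
    proof -
      have "(\<Sum>j\<in>I. left_mult (e i j) * ?w j n) =
          binom_coeff (15/32) n *\<^sub>R ((\<Sum>j\<in>I. left_mult (e i j) * V j) * (1 - h) ^ n)"
        by (simp add: sum_distrib_right scaleR_sum_right mult.assoc)
      also have "(\<Sum>j\<in>I. left_mult (e i j) * V j) = V i"
        by (subst (2) V_def, subst v[OF i])
           (simp add: V_def left_mult_sum left_mult_mult left_mult_scaleR scaleR_sum_right)
      finally show ?thesis .
    qed
    ultimately have "left_mult (w i) = (\<Sum>j\<in>I. left_mult (e i j) * left_mult (w j))"
      using sums_unique2[OF sums[OF i]] by simp
    then have "left_mult (w i) = left_mult (\<Sum>j\<in>I. e i j * w j)"
      by (simp add: left_mult_sum left_mult_mult)
    then show "w i = (\<Sum>j\<in>I. e i j * w j)" by (simp add: left_mult_inj)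
  qed
qed

section \<open>Trace ideals\<close>

lemma hom_regular_ract:
  "f \<in> right_module_hom M regular_module \<Longrightarrow> x \<in> carrier M \<Longrightarrow> f (x \<triangleleft>\<^bsub>M\<^esub> a) = f x * a"
  by (simp add: right_module_hom_def regular_module_def)

lemma finsum_regular:
  fixes f :: "'i \<Rightarrow> 'a::ring"
  assumes "finite S"
  shows "(\<Oplus>\<^bsub>regular_module\<^esub>i\<in>S. f i) = (\<Sum>i\<in>S. f i)"
proof -
  interpret A: right_module "regular_module :: ('a, 'a) rmodule" by (rule right_module_regular)
  show ?thesis
    using assms
  proof (induction S rule: finite_induct)
    case (insert i S)
    then have "(\<Oplus>\<^bsub>regular_module\<^esub>i\<in>insert i S. f i) =
        f i \<oplus>\<^bsub>regular_module\<^esub> (\<Oplus>\<^bsub>regular_module\<^esub>i\<in>S. f i)"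
      by (intro A.finsum_insert) (auto simp: regular_module_def)
    with insert show ?case by (simp add: regular_module_def)
  qed (simp, simp add: regular_module_def)
qed

lemma trace_ideal_hom_image:
  "f \<in> right_module_hom P regular_module \<Longrightarrow> p \<in> carrier P \<Longrightarrow> f p \<in> trace_ideal P"
  unfolding trace_ideal_def by (auto intro!: exI[of _ "1::nat"] exI[of _ "\<lambda>_. f p"])

lemma trace_ideal_induct [consumes 1, case_names zero add]:
  assumes "a \<in> trace_ideal P"
    and zero: "Q 0"
    and add: "\<And>a f p. Q a \<Longrightarrow> f \<in> right_module_hom P regular_module \<Longrightarrow> p \<in> carrier P \<Longrightarrow> Q (a + f p)"
  shows "Q a"
proof -
  obtain n :: nat and c where a: "a = (\<Sum>i<n. c i)"
    and c: "\<forall>i<n. \<exists>f\<in>right_module_hom P regular_module. c i \<in> f ` carrier P"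
    using assms(1) by (auto simp: trace_ideal_def)
  have "Q (\<Sum>i<m. c i)" if "m \<le> n" for m
    using that
  proof (induction m)
    case (Suc m)
    with c obtain f p where "f \<in> right_module_hom P regular_module" "p \<in> carrier P" "c m = f p"
      by (metis Suc_le_eq imageE)
    with Suc add[of "\<Sum>i<m. c i" f p] show ?case by simp
  qed (simp add: zero)
  with a show ?thesis by simp
qed

lemma trace_ideal_zero: "0 \<in> trace_ideal P"
  unfolding trace_ideal_def by (auto intro!: exI[of _ "0::nat"])

lemma trace_ideal_add_hom_image:
  assumes a: "a \<in> trace_ideal P" and f: "f \<in> right_module_hom P regular_module" and p: "p \<in> carrier P"
  shows "a + f p \<in> trace_ideal P"
proof -
  obtain n :: nat and c where "a = (\<Sum>i<n. c i)"
    and "\<forall>i<n. \<exists>f\<in>right_module_hom P regular_module. c i \<in> f ` carrier P"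
    using a by (auto simp: trace_ideal_def)
  with f p show ?thesis
    unfolding trace_ideal_def
    by (intro CollectI exI[of _ "Suc n"] exI[of _ "c(n := f p)"]) (auto simp: less_Suc_eq)
qed

lemma trace_ideal_add:
  assumes a: "a \<in> trace_ideal P" and b: "b \<in> trace_ideal P"
  shows "a + b \<in> trace_ideal P"
  using b
proof (induction rule: trace_ideal_induct)
  case (add b f p)
  then show ?case using trace_ideal_add_hom_image[of "a + b" P f p] by (simp add: add.assoc)
qed (simp add: a)

text \<open>Left multiples and negatives arise by composing a homomorphism f with left
  multiplication or negation, right multiples by evaluating f at p a.\<close>

lemma is_ideal_trace_ideal:
  assumes P: "right_module (P :: ('p, 'a::ring) rmodule)"
  shows "is_ideal (trace_ideal P)"
proof -
  interpret P: right_module P by fact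
  have left: "a * x \<in> trace_ideal P" if "x \<in> trace_ideal P" for a x
    using that
  proof (induction rule: trace_ideal_induct)
    case (add x f p)
    then have "(\<lambda>q. a * f q) \<in> right_module_hom P regular_module"
      by (auto simp: right_module_hom_def regular_module_def algebra_simps)
    from trace_ideal_hom_image[OF this add.hyps(2)] add.IH show ?case
      by (simp add: distrib_left trace_ideal_add)
  qed (simp add: trace_ideal_zero)
  have right: "x * a \<in> trace_ideal P" if "x \<in> trace_ideal P" for a x
    using that
  proof (induction rule: trace_ideal_induct)
    case (add x f p)
    from trace_ideal_hom_image[OF add.hyps(1) P.ract_closed[OF add.hyps(2), of a]]
    have "f p * a \<in> trace_ideal P" using add.hyps by (simp add: hom_regular_ract)
    with add.IH show ?case by (simp add: distrib_right trace_ideal_add)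
  qed (simp add: trace_ideal_zero)
  have minus: "- x \<in> trace_ideal P" if "x \<in> trace_ideal P" for x
    using that
  proof (induction rule: trace_ideal_induct)
    case (add x f p)
    then have "(\<lambda>q. - f q) \<in> right_module_hom P regular_module"
      by (auto simp: right_module_hom_def regular_module_def algebra_simps)
    from trace_ideal_add[OF add.IH trace_ideal_hom_image[OF this add.hyps(2)]] show ?case
      by simp
  qed (simp add: trace_ideal_zero)
  have "x - y \<in> trace_ideal P" if "x \<in> trace_ideal P" "y \<in> trace_ideal P" for x y
    using trace_ideal_add[OF that(1) minus[OF that(2)]] by simp
  with left right show ?thesis by (simp add: is_ideal_def trace_ideal_zero)
qed

lemma is_ideal_sum:
  assumes I: "is_ideal I" and "\<And>j. j \<in> S \<Longrightarrow> f j \<in> I"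
  shows "(\<Sum>j\<in>S. f j) \<in> I"
  using assms(2)
proof (induction S rule: infinite_finite_induct)
  case (insert j S)
  then have "f j \<in> I" "(\<Sum>j\<in>S. f j) \<in> I" by auto
  then have "f j - (0 - (\<Sum>j\<in>S. f j)) \<in> I" using I unfolding is_ideal_def by blast
  with insert.hyps show ?case by simp
qed (use I in \<open>auto simp: is_ideal_def\<close>)

text \<open>The coordinates of a splitting of the free cover lie in \<open>\<int> \<times> A\<close>; their integer parts vanish
  because \<open>P = PA\<close>.\<close>
lemma projective_unital_dual_basis:
  fixes P :: "('p, 'a::ring) rmodule"
  assumes P: "right_module P" and proj: "projective_module P" and unital: "unital_module P"
  obtains \<xi> :: "'p \<Rightarrow> 'p \<Rightarrow> 'a" and S :: "'p \<Rightarrow> 'p set"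
    where "\<And>z. \<xi> z \<in> right_module_hom P regular_module"
      and "\<And>x. x \<in> carrier P \<Longrightarrow> finite (S x) \<and> S x \<subseteq> carrier P"
      and "\<And>x T f. x \<in> carrier P \<Longrightarrow> finite T \<Longrightarrow> S x \<subseteq> T \<Longrightarrow> T \<subseteq> carrier P \<Longrightarrow>
        f \<in> right_module_hom P regular_module \<Longrightarrow> f x = (\<Sum>z\<in>T. f z * \<xi> z x)"
proof -
  interpret P: right_module P by fact
  let ?F = "free_module (carrier P) :: ('p \<Rightarrow> int \<times> 'a, 'a) rmodule"
  obtain s where s: "s \<in> right_module_hom P ?F"
    and se: "\<And>x. x \<in> carrier P \<Longrightarrow> free_eval P (\<lambda>x. x) (s x) = x"
    using projective_module_splits[OF P proj] by blast
  have s_add: "s (x \<oplus>\<^bsub>P\<^esub> y) = (\<lambda>z. (fst (s x z) + fst (s y z), snd (s x z) + snd (s y z)))"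
    if "x \<in> carrier P" "y \<in> carrier P" for x y
    using right_module_homD(2)[OF s that] by (simp add: free_module_def)
  have s_ract: "s (x \<triangleleft>\<^bsub>P\<^esub> a) = (\<lambda>z. (0, unitization_mult (s x z) a))"
    if "x \<in> carrier P" for x a
    using right_module_homD(3)[OF s that] by (simp add: free_module_def)
  have fst_sum: "fst (s (\<Oplus>\<^bsub>P\<^esub>i\<in>{..<n}. y i \<triangleleft>\<^bsub>P\<^esub> b i) z) = 0"
    if "\<forall>i<n. y i \<in> carrier P" for n :: nat and y b z
    using that
  proof (induction n)
    case 0
    show ?case using hom_zero[OF P right_module_free s] by (simp add: free_module_def)
  next
    case (Suc n)
    then have cl: "(\<lambda>i. y i \<triangleleft>\<^bsub>P\<^esub> b i) \<in> {..<n} \<rightarrow> carrier P" "y n \<triangleleft>\<^bsub>P\<^esub> b n \<in> carrier P"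
      by (auto intro!: P.ract_closed)
    have "(\<Oplus>\<^bsub>P\<^esub>i\<in>{..<Suc n}. y i \<triangleleft>\<^bsub>P\<^esub> b i) =
        y n \<triangleleft>\<^bsub>P\<^esub> b n \<oplus>\<^bsub>P\<^esub> (\<Oplus>\<^bsub>P\<^esub>i\<in>{..<n}. y i \<triangleleft>\<^bsub>P\<^esub> b i)"
      unfolding lessThan_Suc using cl by (intro P.finsum_insert) auto
    then show ?case
      using Suc cl P.finsum_closed[OF cl(1)] by (simp add: s_add s_ract)
  qed
  have fst0: "fst (s x z) = 0" if x: "x \<in> carrier P" for x z
    using unital x fst_sum unfolding unital_module_def by metis
  then have s_eq: "s x z = (0, snd (s x z))" if "x \<in> carrier P" for x z
    using that by (simp add: prod_eq_iff)
  show thesis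
  \<comment> \<open>The coordinates are the A-components of the splitting s, and S x is the support
    of s x. Enlarging it to T adds only zero terms, which lets several elements share one index
    set.\<close>
  proof (rule that[of "\<lambda>z x. snd (s x z)" "\<lambda>x. usupp (s x)"])
    show "(\<lambda>x. snd (s x z)) \<in> right_module_hom P regular_module" for z
    proof -
      have "snd (s (x \<triangleleft>\<^bsub>P\<^esub> a) z) = snd (s x z) * a" if "x \<in> carrier P" for x a
        using unitization_mult_0[of "snd (s x z)" a] s_eq[OF that, of z] that by (simp add: s_ract)
      then show ?thesis by (auto simp: right_module_hom_def regular_module_def s_add)
    qed
    show supp: "finite (usupp (s x)) \<and> usupp (s x) \<subseteq> carrier P" if "x \<in> carrier P" for x
      using right_module_homD(1)[OF s that] by (simp add: free_module_def)
    fix x T and f :: "'p \<Rightarrow> 'a"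
    assume x: "x \<in> carrier P" and T: "finite T" "usupp (s x) \<subseteq> T" "T \<subseteq> carrier P"
      and f: "f \<in> right_module_hom P regular_module"
    have id: "(\<lambda>z. z) \<in> T \<rightarrow> carrier P" using T by auto
    have "unitization_act P z (s x z) = z \<triangleleft>\<^bsub>P\<^esub> snd (s x z)" if "z \<in> carrier P" for z
      using that fst0[OF x] by (simp add: unitization_act_def int_act_zero P.ract_closed)
    then have "(\<Oplus>\<^bsub>P\<^esub>z\<in>T. z \<triangleleft>\<^bsub>P\<^esub> snd (s x z)) = (\<Oplus>\<^bsub>P\<^esub>z\<in>T. unitization_act P z (s x z))"
      using T by (intro P.add.finprod_cong') (auto intro!: P.unitization_act_closed)
    also have "\<dots> = x"
      using P.free_eval_superset[OF T(1,2) id] se[OF x] by simp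
    finally have "f x = f (\<Oplus>\<^bsub>P\<^esub>z\<in>T. z \<triangleleft>\<^bsub>P\<^esub> snd (s x z))" by simp
    also have "\<dots> = (\<Oplus>\<^bsub>regular_module\<^esub>z\<in>T. f (z \<triangleleft>\<^bsub>P\<^esub> snd (s x z)))"
      using T by (intro hom_finsum[OF P right_module_regular f]) (auto intro!: P.ract_closed)
    also have "\<dots> = (\<Sum>z\<in>T. f (z \<triangleleft>\<^bsub>P\<^esub> snd (s x z)))" by (rule finsum_regular[OF T(1)])
    also have "\<dots> = (\<Sum>z\<in>T. f z * snd (s x z))"
      using T by (intro sum.cong) (auto intro!: hom_regular_ract[OF f])
    finally show "f x = (\<Sum>z\<in>T. f z * snd (s x z))" .
  qed
qed

text \<open>Write b as the sum of f_k(p_k). The dual basis expands this into the row f_k(z) times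
  the column \<xi>_z(p_k). Expanding each \<xi>_z(p_k) in the same way shows that the matrix
  \<xi>_z(z') fixes the column, and its entries are values of homomorphisms.\<close>

lemma trace_ideal_fixed_column:
  fixes P :: "('p, 'a::ring) rmodule"
  assumes P: "right_module P" "projective_module P" "unital_module P"
    and b: "b \<in> trace_ideal P"
  obtains I :: "('p \<times> nat) set" and r v e where "finite I" "b = (\<Sum>i\<in>I. r i * v i)"
    and "\<And>i. i \<in> I \<Longrightarrow> v i = (\<Sum>j\<in>I. e i j * v j)"
    and "\<And>i j. i \<in> I \<Longrightarrow> j \<in> I \<Longrightarrow> e i j \<in> trace_ideal P"
proof -
  obtain \<xi> S where \<xi>: "\<And>z. \<xi> z \<in> right_module_hom P regular_module"
    and S: "\<And>x. x \<in> carrier P \<Longrightarrow> finite (S x) \<and> S x \<subseteq> carrier P"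
    and dual: "\<And>x T f. x \<in> carrier P \<Longrightarrow> finite T \<Longrightarrow> S x \<subseteq> T \<Longrightarrow> T \<subseteq> carrier P \<Longrightarrow>
        f \<in> right_module_hom P regular_module \<Longrightarrow> f x = (\<Sum>z\<in>T. f z * \<xi> z x)"
    using projective_unital_dual_basis[OF P] by blast
  obtain n :: nat and c where b: "b = (\<Sum>k<n. c k)"
    and "\<forall>k<n. \<exists>f\<in>right_module_hom P regular_module. c k \<in> f ` carrier P"
    using b by (auto simp: trace_ideal_def)
  then have "\<exists>f p. k < n \<longrightarrow> f \<in> right_module_hom P regular_module \<and> p \<in> carrier P \<and> c k = f p" for k
    by blast
  then obtain f p where f: "\<And>k. k < n \<Longrightarrow> f k \<in> right_module_hom P regular_module"
    and p: "\<And>k. k < n \<Longrightarrow> p k \<in> carrier P" and c: "\<And>k. k < n \<Longrightarrow> c k = f k (p k)"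
    by metis
  define T where "T = (\<Union>k<n. S (p k))"
  have T: "finite T" "T \<subseteq> carrier P" using S p by (auto simp: T_def)
  have dualT: "g (p k) = (\<Sum>z\<in>T. g z * \<xi> z (p k))"
    if "k < n" "g \<in> right_module_hom P regular_module" for k g
    using that by (intro dual p T) (auto simp: T_def)
  define v where "v = (\<lambda>(z, k). \<xi> z (p k))"
  define r where "r = (\<lambda>(z, k). f k z)"
  \<comment> \<open>Block diagonal, with one copy of the matrix \<xi>_z(z') for each k, so that the
    columns of different k do not mix.\<close>
  define e where "e i j = (if snd i = snd j then \<xi> (fst i) (fst j) else 0)" for i j :: "'p \<times> nat"
  show thesis
  proof (rule that[of "T \<times> {..<n}" r v e])
    show "finite (T \<times> {..<n})" using T by simp
    have "b = (\<Sum>k<n. \<Sum>z\<in>T. f k z * \<xi> z (p k))"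
      unfolding b by (intro sum.cong) (auto simp: c intro!: dualT f)
    also have "\<dots> = (\<Sum>i\<in>T \<times> {..<n}. r i * v i)"
      by (subst sum.swap) (simp add: sum.cartesian_product r_def v_def split_beta)
    finally show "b = (\<Sum>i\<in>T \<times> {..<n}. r i * v i)" .
    show "v i = (\<Sum>j\<in>T \<times> {..<n}. e i j * v j)" if i: "i \<in> T \<times> {..<n}" for i
    proof -
      obtain z k where [simp]: "i = (z, k)" by (cases i)
      have "(\<Sum>j\<in>T \<times> {..<n}. e i j * v j) =
          (\<Sum>z'\<in>T. \<Sum>k'<n. if k = k' then \<xi> z z' * \<xi> z' (p k') else 0)"
        unfolding sum.cartesian_product by (intro sum.cong) (auto simp: e_def v_def)
      also have "\<dots> = \<xi> z (p k)" using i by (simp add: dualT[OF _ \<xi>, symmetric])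
      finally show ?thesis by (simp add: v_def)
    qed
    show "e i j \<in> trace_ideal P" if "i \<in> T \<times> {..<n}" "j \<in> T \<times> {..<n}" for i j
      using that T by (auto simp: e_def trace_ideal_zero intro!: trace_ideal_hom_image[OF \<xi>])
  qed
qed

theorem corollary5p8:
  fixes P :: "('p, 'a::cstar_algebra) rmodule"
  assumes "right_module P"
    and "projective_module P"
    and "unital_module P"
  shows "semiprime_ideal (trace_ideal P)"
proof -
  have ideal: "is_ideal (trace_ideal P)" by (rule is_ideal_trace_ideal) fact
  have "x \<in> trace_ideal P"
    if J: "is_ideal J" "ideal_square J \<subseteq> trace_ideal P" and x: "x \<in> J" for J x
  proof -
    \<comment> \<open>A left multiple of x, hence in J; its product with x is then a generator of
      J^2.\<close>
    have "star x * x \<in> J" using J(1) x by (simp add: is_ideal_def)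
    with x have "x * (star x * x) \<in> ideal_square J"
      unfolding ideal_square_def by (intro group_closure.base) auto
    with J(2) have "x * (star x * x) \<in> trace_ideal P" by blast
    then obtain I :: "('p \<times> nat) set" and r v e
      where I: "finite I" "x * (star x * x) = (\<Sum>i\<in>I. r i * v i)"
        and v: "\<And>i. i \<in> I \<Longrightarrow> v i = (\<Sum>j\<in>I. e i j * v j)"
        and e: "\<And>i j. i \<in> I \<Longrightarrow> j \<in> I \<Longrightarrow> e i j \<in> trace_ideal P"
      using trace_ideal_fixed_column[OF assms] by blast
    obtain y w where xw: "x = (\<Sum>i\<in>I. y i * w i)"
      and w: "\<And>i. i \<in> I \<Longrightarrow> w i = (\<Sum>j\<in>I. e i j * w j)"
      using factorization_through_fixed_column[OF I v] by blast
    \<comment> \<open>Although w is an infinite series, w = e w writes each entry as a finite sum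
      whose left factors lie in the trace ideal.\<close>
    have "w i \<in> trace_ideal P" if i: "i \<in> I" for i
      by (subst w[OF i], rule is_ideal_sum[OF ideal]) (use e[OF i] ideal in \<open>simp add: is_ideal_def\<close>)
    then show ?thesis
      by (subst xw, intro is_ideal_sum[OF ideal]) (use ideal in \<open>simp add: is_ideal_def\<close>)
  qed
  with ideal show ?thesis unfolding semiprime_ideal_def by blast
qed

end
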